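(* Consider the problem, the i.i.d. sampling and multiplicative noise assumptions, and Algorithm 1 described in the context. Suppose that $\{\alpha_t\}$ is non-increasing and $$\alpha_t\in\left(0,\frac1L\right),\qquad \beta_t\ge1,\qquad \beta_t^2=\beta_{t+1}^2-\beta_{t+1},\qquad\forall t\in\mathbb{N},$$ and that the sequence $\{y^t,z^t\}$ is generated by Algorithm 1. Let $\mu\in(0,1)$, $a,b,\delta>0$, $N_0\in\mathbb{N}$ and set for all $t\in\mathbb{N}$ $$\beta_t:=\frac{1+t}{2},\qquad \alpha_t:=\frac{\mu}{L+\frac{a}{\sqrt{N_0}}},\qquad N_t:=N_0\left\lceil (t+2+\delta)^3[\ln(t+2+\delta)]^{1+2b}\right\rceil .$$ Choose $\phi\in(0,1)$ and let $$t_0:=\max\left\{\left\lceil \exp\left\{\sqrt[2b]{\frac{15(\alpha_1\sigma_L)^2}{8\phi N_0 b}}\right\}-1-\delta\right\rceil,\,1\right\}$$ (the numbers $\phi$ and $t_0$ do not enter the conclusion explicitly). Given $\epsilon>0$, Algorithm 1 achieves the tolerance $\mathbb{E}[g(z^T)-g^*]\le\epsilon$ after $T=\mathcal{O}(\epsilon^{-\frac12})$ iterations using an oracle complexity (total number of samples) of $$\sum_{\tau=1}^{T}N_\tau\le\mathcal{O}\left(\epsilon^{-2}\right)\left[\ln\left(\epsilon^{-\frac12}\right)\right]^2 .$$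
   Context: The $\mathcal{O}(\cdot)$ symbols refer to $\epsilon\to0^+$, with constants not depending on $\epsilon$. Setting. $\mathbb{N}=\{1,2,\dots\}$; $\lceil x\rceil$ is the smallest integer $\ge x$; $\|\cdot\|$ is the Euclidean norm. $X\subset\mathbb{R}^d$ is closed and convex, $\mathbf{P}$ is a probability distribution on $\Xi$, and $F:X\times\Xi\to\mathbb{R}$ is measurable, such that for a.e. $\xi$ the function $F(\cdot,\xi)$ is convex and continuously differentiable, and $F(x,\cdot)$, $\nabla F(x,\cdot)$ are integrable for every $x\in X$. Here $\nabla F$ is the gradient in $x$. Set $f(x):=\mathbb{E}[F(x,\xi)]$ with $\xi\sim\mathbf{P}$; $f$ is convex and differentiable on $X$ with $\nabla f(x)=\mathbb{E}[\nabla F(x,\xi)]$, and for some $L>0$, $\|\nabla f(x)-\nabla f(y)\|\le L\|x-y\|$ for all $x,y\in X$. $\varphi:X\to\mathbb{R}$ is a (possibly nonsmooth) convex function whose proximal minimizations (as in the algorithm below) are well defined. The problem is $g^*:=\min_{x\in X}\{g(x):=f(x)+\varphi(x)\}$, with solution set $S(f,\varphi)$. Multiplicative noise assumption. Let $\sigma(x):=\sqrt{\mathbb{E}[\|\nabla F(x,\xi)-\nabla f(x)\|^2]}$. There is $x^0\in X$ with $\sigma(x^0)<\infty$, and there is $\sigma_L>0$ such that $\sigma(x)\le\sigma(x^* )+\sigma_L\|x-x^*\|$ for all $x,x^*\in X$. Algorithm 1. Inputs: initial points $y^1=z^0\in X$, stepsizes $\alpha_t>0$, weights $\beta_t>0$,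 batch sizes $N_t\in\mathbb{N}$. At iteration $t\ge1$, given $y^t,z^{t-1}$, draw an i.i.d. sample $\xi^t=\{\xi^t_j\}_{j=1}^{N_t}$ from $\mathbf{P}$, independent of all previous samples, put $F'_t(y^t,\xi^t):=\frac1{N_t}\sum_{j=1}^{N_t}\nabla F(y^t,\xi^t_j)$ and $$z^t:=\operatorname*{argmin}_{x\in X}\left\{f(y^t)+\langle F'_t(y^t,\xi^t),x-y^t\rangle+\frac{1}{2\alpha_t}\|x-y^t\|^2+\varphi(x)\right\},\qquad y^{t+1}:=\frac{\beta_t-1}{\beta_{t+1}}(z^t-z^{t-1})+z^t.$$ It is implicit that the points $y^t$ lie in $X$, the domain where $F(\cdot,\xi)$ and $f$ are defined (automatic if $X=\mathbb{R}^d$).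
   Formalization: The equation β_t²=β_{t+1}²−β_{t+1}, inconsistent with β_t=(1+t)/2, is relaxed to β_{t+1}²−β_{t+1}≤β_t², and the exponent 2 of the logarithm, which fails for b>1/2, is replaced by max(2,1+2b). *)

theory Defs
  imports "HOL-Probability.Probability" "HOL-Library.Landau_Symbols"
begin

definition mean_objective :: "'s measure \<Rightarrow> ('a \<Rightarrow> 's \<Rightarrow> real) \<Rightarrow> 'a \<Rightarrow> real" where
  "mean_objective P F x = (\<integral>\<xi>. F x \<xi> \<partial>P)"

definition mean_gradient ::
  "'s measure \<Rightarrow> ('a \<Rightarrow> 's \<Rightarrow> 'a::euclidean_space) \<Rightarrow> 'a \<Rightarrow> 'a" where
  "mean_gradient P dF x = (\<integral>\<xi>. dF x \<xi> \<partial>P)"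

definition composite_objective ::
  "'s measure \<Rightarrow> ('a \<Rightarrow> 's \<Rightarrow> real) \<Rightarrow> ('a \<Rightarrow> real) \<Rightarrow> 'a \<Rightarrow> real" where
  "composite_objective P F \<phi> x = mean_objective P F x + \<phi> x"

definition solution_set :: "'a set \<Rightarrow> ('a \<Rightarrow> real) \<Rightarrow> 'a set" where
  "solution_set X g = {x. is_arg_min g (\<lambda>x. x \<in> X) x}"

definition optimal_value :: "'a set \<Rightarrow> ('a \<Rightarrow> real) \<Rightarrow> real" where
  "optimal_value X g = (INF x\<in>X. g x)"

text \<open>The standard deviation is extended-valued: a Bochner integral would return 0, not
  infinity, at points where the second moment is infinite.\<close>

definition noise_sd ::
  "'s measure \<Rightarrow> ('a \<Rightarrow> 's \<Rightarrow> 'a::euclidean_space) \<Rightarrow> 'a \<Rightarrow> ennreal" where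
  "noise_sd P dF x =
     (let v = (\<integral>\<^sup>+\<xi>. ennreal ((norm (dF x \<xi> - mean_gradient P dF x))\<^sup>2) \<partial>P)
      in if v = \<infinity> then \<infinity> else ennreal (sqrt (enn2real v)))"

definition multiplicative_noise ::
  "'s measure \<Rightarrow> 'a::euclidean_space set \<Rightarrow> ('a \<Rightarrow> 's \<Rightarrow> 'a) \<Rightarrow> real \<Rightarrow> bool" where
  "multiplicative_noise P X dF \<sigma>L \<longleftrightarrow>
     0 < \<sigma>L \<and>
     (\<exists>x0\<in>X. noise_sd P dF x0 < \<infinity>) \<and>
     (\<forall>x\<in>X. \<forall>x'\<in>X. noise_sd P dF x \<le> noise_sd P dF x' + ennreal (\<sigma>L * norm (x - x')))"

definition prox_model ::
  "real \<Rightarrow> ('a::euclidean_space \<Rightarrow> real) \<Rightarrow> real \<Rightarrow> 'a \<Rightarrow> 'a \<Rightarrow> 'a \<Rightarrow> real" where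
  "prox_model c \<phi> \<gamma> y v x = c + v \<bullet> (x - y) + 1 / (2 * \<gamma>) * (norm (x - y))\<^sup>2 + \<phi> x"

text \<open>\<open>dF\<close> is the gradient of \<open>F\<close> in its first argument. Derivatives are taken within \<open>X\<close>, as
  \<open>F\<close> is only given there. If \<open>X\<close> has empty interior such a gradient is not unique, and \<open>dF\<close> is
  one fixed choice of it, which therefore carries its own measurability assumption.\<close>

locale stochastic_composite_problem = prob_space P
  for P :: "'s measure" +
  fixes X :: "'a::euclidean_space set"
    and F :: "'a \<Rightarrow> 's \<Rightarrow> real"
    and dF :: "'a \<Rightarrow> 's \<Rightarrow> 'a"
    and \<phi> :: "'a \<Rightarrow> real"
    and L :: real
  assumes closed_X: "closed X"
    and convex_X: "convex X"
    and F_measurable: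
      "(\<lambda>(x, \<xi>). F x \<xi>) \<in> borel_measurable (restrict_space borel X \<Otimes>\<^sub>M P)"
    and dF_measurable:
      "(\<lambda>(x, \<xi>). dF x \<xi>) \<in> borel_measurable (restrict_space borel X \<Otimes>\<^sub>M P)"
    and F_convex: "AE \<xi> in P. convex_on X (\<lambda>x. F x \<xi>)"
    and F_gradient:
      "AE \<xi> in P. \<forall>x\<in>X. ((\<lambda>x. F x \<xi>) has_derivative (\<lambda>h. dF x \<xi> \<bullet> h)) (at x within X)"
    and dF_continuous: "AE \<xi> in P. continuous_on X (\<lambda>x. dF x \<xi>)"
    and F_integrable: "x \<in> X \<Longrightarrow> integrable P (F x)"
    and dF_integrable: "x \<in> X \<Longrightarrow> integrable P (dF x)"
    and f_convex: "convex_on X (mean_objective P F)"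
    and f_gradient: "x \<in> X \<Longrightarrow>
      (mean_objective P F has_derivative (\<lambda>h. mean_gradient P dF x \<bullet> h)) (at x within X)"
    and L_pos: "0 < L"
    and gradient_Lipschitz: "\<lbrakk>x \<in> X; y \<in> X\<rbrakk> \<Longrightarrow>
      norm (mean_gradient P dF x - mean_gradient P dF y) \<le> L * norm (x - y)"
    and \<phi>_convex: "convex_on X \<phi>"
    and prox_well_defined: "\<lbrakk>0 < \<gamma>; y \<in> X\<rbrakk> \<Longrightarrow>
      \<exists>x. is_arg_min (prox_model (mean_objective P F y) \<phi> \<gamma> y v) (\<lambda>x. x \<in> X) x"
    and solution_exists: "solution_set X (composite_objective P F \<phi>) \<noteq> {}"

definition minibatch_gradient ::
  "('a::euclidean_space \<Rightarrow> 's \<Rightarrow> 'a) \<Rightarrow> nat \<Rightarrow> (nat \<Rightarrow> 's) \<Rightarrow> 'a \<Rightarrow> 'a" where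
  "minibatch_gradient dF n \<xi> y = (1 / real n) *\<^sub>R (\<Sum>j = 1..n. dF y (\<xi> j))"

text \<open>\<open>\<xi> t j \<omega>\<close> is the \<open>j\<close>-th draw of iteration \<open>t\<close>. Batches that are i.i.d. and independent of the
  previous ones amount to joint independence of all draws. The iterates are indexed by \<open>t \<ge> 1\<close>,
  except that \<open>z\<close> starts at index 0; the minimizer defining \<open>z t\<close> is unique by strong convexity.\<close>

definition accelerated_run ::
  "'w measure \<Rightarrow> 's measure \<Rightarrow> 'a::euclidean_space set \<Rightarrow> ('a \<Rightarrow> 's \<Rightarrow> real) \<Rightarrow> ('a \<Rightarrow> 's \<Rightarrow> 'a) \<Rightarrow>
    ('a \<Rightarrow> real) \<Rightarrow> (nat \<Rightarrow> real) \<Rightarrow> (nat \<Rightarrow> real) \<Rightarrow> (nat \<Rightarrow> nat) \<Rightarrow> (nat \<Rightarrow> nat \<Rightarrow> 'w \<Rightarrow> 's) \<Rightarrow>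
    'a \<Rightarrow> (nat \<Rightarrow> 'w \<Rightarrow> 'a) \<Rightarrow> (nat \<Rightarrow> 'w \<Rightarrow> 'a) \<Rightarrow> bool" where
  "accelerated_run M P X F dF \<phi> \<alpha> \<beta> N \<xi> x1 y z \<longleftrightarrow>
     prob_space M \<and>
     prob_space.indep_vars M (\<lambda>_. P) (\<lambda>(t, j). \<xi> t j) {(t, j). 1 \<le> t \<and> 1 \<le> j \<and> j \<le> N t} \<and>
     (\<forall>t\<ge>1. \<forall>j\<in>{1..N t}. distr M P (\<xi> t j) = P) \<and>
     x1 \<in> X \<and>
     (\<forall>\<omega>\<in>space M. y 1 \<omega> = x1 \<and> z 0 \<omega> = x1) \<and>
     (\<forall>t\<ge>1. \<forall>\<omega>\<in>space M.
        y t \<omega> \<in> X \<and>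
        is_arg_min
          (prox_model (mean_objective P F (y t \<omega>)) \<phi> (\<alpha> t) (y t \<omega>)
             (minibatch_gradient dF (N t) (\<lambda>j. \<xi> t j \<omega>) (y t \<omega>)))
          (\<lambda>x. x \<in> X) (z t \<omega>) \<and>
        y (t + 1) \<omega> = ((\<beta> t - 1) / \<beta> (t + 1)) *\<^sub>R (z t \<omega> - z (t - 1) \<omega>) + z t \<omega>)"

end

theory Submission
  imports Defs
begin

text \<open>
  The iterates are compared with one fixed solution \<open>xs\<close>. With \<open>\<gamma>\<close> the constant stepsize and
  \<open>s t = z t + (\<beta> t - 1) (z t - z (t - 1))\<close>, the potential of accelerated proximal gradient descent
  is \<open>V t = 2 \<gamma> (\<beta> t)\<^sup>2 (g (z t) - g xs) + (norm (s t - xs))\<^sup>2\<close>. Without noise it does not increase.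
  An error \<open>w\<close> in the gradient at iteration \<open>t\<close> adds a term linear in \<open>w\<close>, of the form
  \<open>2 \<gamma> \<beta> t (w \<bullet> (xs - s (t - 1)))\<close>, and a multiple of \<open>(\<beta> t)\<^sup>2 (norm w)\<^sup>2\<close>
  (\<open>accelerated_potential_step\<close>).

  The linear term has expectation zero, because \<open>s (t - 1)\<close> is determined by the earlier draws. The
  draws inside a batch are uncorrelated given the past, so the quadratic term has expectation at most
  \<open>2 (\<sigma>s\<^sup>2 + \<sigma>L\<^sup>2 E (norm (y t - xs))\<^sup>2) / N t\<close> times that multiple. The noise is multiplicative, hence
  this is only useful if \<open>y t\<close> has bounded second moments, which is not known in advance. However,
  \<open>y t\<close> is a convex combination of \<open>z (t - 1)\<close> and \<open>s (t - 1)\<close>, and \<open>z t\<close> is one of \<open>z (t - 1)\<close> and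
  \<open>s t\<close>; so their mean square distances to \<open>xs\<close> are controlled by the largest mean potential so far.
  A Gronwall argument then closes the loop: for a constant \<open>c\<close>, one plus the running bound on
  the mean potential grows at iteration \<open>t\<close> by a factor of at most \<open>exp (c (\<beta> t)\<^sup>2 / N t)\<close>
  (\<open>potential_bounded\<close>).

  For the given parameters \<open>(\<beta> t)\<^sup>2 / N t\<close> is at most a constant times
  \<open>1 / (x (ln x) powr (1 + 2 * b))\<close> at \<open>x = t + 2 + \<delta>\<close>, and these terms have bounded partial sums.
  So the mean potential is bounded and the mean gap at \<open>z t\<close> is of order \<open>1 / t\<^sup>2\<close>. A tolerance
  \<open>\<epsilon>\<close> therefore takes of order \<open>\<epsilon> powr (- 1 / 2)\<close> iterations, and summing the batch sizes gives
  a fourth power of this number times the logarithmic factor.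

  Measurability needs care, since a convex function on a closed convex set need not be
  Borel measurable on the boundary of the set. The iterates \<open>z t\<close> are proximal points, and along
  proximal points \<open>\<phi>\<close> is a continuous function of the point to which the proximal map is applied
  (\<open>continuous_on_prox\<close>); this makes the gap at \<open>z t\<close> a random variable.\<close>

section \<open>The proximal gradient step with an inexact gradient\<close>

text \<open>Completing the square. The gradient and the base point enter the minimization only through the
point \<open>y - \<gamma> v\<close>, so every iterate is the value of one proximal map.\<close>

lemma prox_model_shift:
  assumes "0 < \<gamma>"
  shows "prox_model c \<phi> \<gamma> y v x =
    (c - \<gamma> / 2 * (norm v)\<^sup>2) + prox_model 0 \<phi> \<gamma> (y - \<gamma> *\<^sub>R v) 0 x"
proof -
  have "(norm (x - (y - \<gamma> *\<^sub>R v)))\<^sup>2 = (norm (x - y))\<^sup>2 + 2 * \<gamma> * (v \<bullet> (x - y)) + \<gamma>\<^sup>2 * (norm v)\<^sup>2"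
    unfolding power2_norm_eq_inner
    by (simp add: inner_diff inner_add algebra_simps inner_commute power2_eq_square)
  then show ?thesis
    using assms by (simp add: prox_model_def field_simps power2_eq_square)
qed

lemma is_arg_min_prox_model_shift:
  assumes "0 < \<gamma>"
  shows "is_arg_min (prox_model c \<phi> \<gamma> y v) A z \<longleftrightarrow>
    is_arg_min (prox_model c' \<phi> \<gamma> (y - \<gamma> *\<^sub>R v) 0) A z"
  unfolding is_arg_min_linorder
  by (simp add: prox_model_shift[OF assms, of c] prox_model_shift[OF assms, of c' _ _ 0])

text \<open>The model is strongly convex with modulus \<open>1 / \<gamma>\<close>, so it exceeds its minimum quadratically. The
proof compares the minimizer with points on the segment to \<open>x\<close> and lets them tend to the minimizer.\<close>

lemma prox_three_point:
  fixes X :: "'a::euclidean_space set"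
  assumes "convex X" "convex_on X \<phi>" "0 < \<gamma>"
    and min: "is_arg_min (prox_model c \<phi> \<gamma> y v) (\<lambda>x. x \<in> X) z"
    and x: "x \<in> X"
  shows "prox_model c \<phi> \<gamma> y v z + 1 / (2 * \<gamma>) * (norm (x - z))\<^sup>2 \<le> prox_model c \<phi> \<gamma> y v x"
proof -
  have z: "z \<in> X" using min by (simp add: is_arg_min_linorder)
  define r where "r = 1 / (2 * \<gamma>) * (norm (x - z))\<^sup>2"
  define D where "D = prox_model c \<phi> \<gamma> y v x - prox_model c \<phi> \<gamma> y v z - r"
  \<comment> \<open>The optimality of \<open>z\<close> against the point at fraction \<open>\<tau>\<close> of the segment, divided by \<open>\<tau>\<close>.\<close>
  have "0 \<le> D + r * \<tau>" if \<tau>: "0 < \<tau>" "\<tau> < 1" for \<tau> :: real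
  proof -
    let ?p = "(1 - \<tau>) *\<^sub>R z + \<tau> *\<^sub>R x"
    have p: "?p \<in> X" using convexD_alt[OF \<open>convex X\<close> z x] \<tau> by simp
    have phi: "\<phi> ?p \<le> (1 - \<tau>) * \<phi> z + \<tau> * \<phi> x"
      using convex_onD[OF \<open>convex_on X \<phi>\<close>, of \<tau> z x] \<tau> z x by simp
    have sq: "(norm (?p - y))\<^sup>2 =
        (1 - \<tau>) * (norm (z - y))\<^sup>2 + \<tau> * (norm (x - y))\<^sup>2 - \<tau> * (1 - \<tau>) * (norm (x - z))\<^sup>2"
      unfolding power2_norm_eq_inner
      by (simp add: inner_diff inner_add algebra_simps inner_commute power2_eq_square)
    have lin: "v \<bullet> (?p - y) = (1 - \<tau>) * (v \<bullet> (z - y)) + \<tau> * (v \<bullet> (x - y))"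
      by (simp add: inner_diff inner_add algebra_simps)
    have "prox_model c \<phi> \<gamma> y v z \<le> prox_model c \<phi> \<gamma> y v ?p"
      using min p by (simp add: is_arg_min_linorder)
    also have "\<dots> \<le> prox_model c \<phi> \<gamma> y v z + \<tau> * (D + r * \<tau>)"
      using phi unfolding prox_model_def sq lin D_def r_def by (simp add: algebra_simps)
    finally show ?thesis using \<tau> by (simp add: zero_le_mult_iff)
  qed
  then have "eventually (\<lambda>\<tau>. 0 \<le> D + r * \<tau>) (at_right 0)"
    by (auto simp: eventually_at_right_field intro!: exI[of _ 1])
  moreover have "((\<lambda>\<tau>. D + r * \<tau>) \<longlongrightarrow> D + r * 0) (at_right 0)"
    by (intro tendsto_intros)
  ultimately have "0 \<le> D + r * 0"
    by (intro tendsto_lowerbound[where F = "at_right 0"]) auto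
  then show ?thesis by (simp add: D_def r_def)
qed

text \<open>Add the three-point inequality for each minimizer, tested at the other one. With \<open>u = w\<close> this is also
the uniqueness of the minimizer.\<close>

lemma prox_nonexpansive:
  fixes X :: "'a::euclidean_space set"
  assumes "convex X" "convex_on X \<phi>" "0 < \<gamma>"
    and p: "is_arg_min (prox_model 0 \<phi> \<gamma> u 0) (\<lambda>x. x \<in> X) p"
    and q: "is_arg_min (prox_model 0 \<phi> \<gamma> w 0) (\<lambda>x. x \<in> X) q"
  shows "norm (p - q) \<le> norm (u - w)"
proof -
  have X: "p \<in> X" "q \<in> X" using p q by (simp_all add: is_arg_min_linorder)
  have "((norm (p - u))\<^sup>2 + (norm (q - p))\<^sup>2 + (norm (q - w))\<^sup>2 + (norm (p - q))\<^sup>2) / (2 * \<gamma>)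
      \<le> ((norm (q - u))\<^sup>2 + (norm (p - w))\<^sup>2) / (2 * \<gamma>)"
    using prox_three_point[OF assms(1-3) p X(2)] prox_three_point[OF assms(1-3) q X(1)]
    by (simp add: prox_model_def add_divide_distrib)
  then have "(norm (p - u))\<^sup>2 + (norm (q - p))\<^sup>2 + (norm (q - w))\<^sup>2 + (norm (p - q))\<^sup>2
      \<le> (norm (q - u))\<^sup>2 + (norm (p - w))\<^sup>2"
    using \<open>0 < \<gamma>\<close> by (simp add: divide_le_cancel)
  then have "norm (p - q) * norm (p - q) \<le> (p - q) \<bullet> (u - w)"
    by (simp add: power2_norm_eq_inner inner_diff algebra_simps inner_commute
        flip: power2_eq_square)
  also have "\<dots> \<le> norm (p - q) * norm (u - w)" by (rule norm_cauchy_schwarz)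
  finally show ?thesis
    by (cases "p = q") (auto simp: mult_le_cancel_left)
qed

text \<open>Although \<open>\<phi>\<close> may be discontinuous on \<open>X\<close>, it is continuous along proximal points: the optimality of
\<open>p u\<close>, tested at \<open>p w\<close>, bounds \<open>\<phi> (p u) - \<phi> (p w)\<close> by a difference of squared distances, and the
same holds with \<open>u\<close> and \<open>w\<close> exchanged.\<close>

lemma continuous_on_prox:
  fixes X :: "'a::euclidean_space set"
  assumes "convex X" "convex_on X \<phi>" "0 < \<gamma>"
    and p: "\<And>u. is_arg_min (prox_model 0 \<phi> \<gamma> u 0) (\<lambda>x. x \<in> X) (p u)"
  shows "continuous_on UNIV p" "continuous_on UNIV (\<lambda>u. \<phi> (p u))"
proof -
  have dist: "dist (p u) (p w) \<le> dist u w" for u w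
    using prox_nonexpansive[OF assms(1-3) p p] by (simp add: dist_norm)
  show cont: "continuous_on UNIV p"
    unfolding continuous_on_iff using dist by (meson order.strict_trans1)
  have phi: "\<phi> (p u) - \<phi> (p w) \<le> ((norm (p w - u))\<^sup>2 - (norm (p u - u))\<^sup>2) / (2 * \<gamma>)" for u w
  proof -
    have "prox_model 0 \<phi> \<gamma> u 0 (p u) \<le> prox_model 0 \<phi> \<gamma> u 0 (p w)"
      using p[of u] p[of w] by (simp add: is_arg_min_linorder)
    then show ?thesis by (simp add: prox_model_def diff_divide_distrib)
  qed
  show "continuous_on UNIV (\<lambda>u. \<phi> (p u))"
  proof (rule continuous_at_imp_continuous_on, rule ballI)
    fix u
    have p_u: "p \<midarrow>u\<rightarrow> p u" using cont by (simp add: continuous_on_def)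
    have "((\<lambda>w. \<phi> (p w) - \<phi> (p u)) \<longlongrightarrow> 0) (at u)"
    proof (rule tendsto_sandwich[OF always_eventually always_eventually]; (intro allI)?)
      show "- (((norm (p w - u))\<^sup>2 - (norm (p u - u))\<^sup>2) / (2 * \<gamma>)) \<le> \<phi> (p w) - \<phi> (p u)" for w
        using phi[of u w] by simp
      show "\<phi> (p w) - \<phi> (p u) \<le> ((norm (p u - w))\<^sup>2 - (norm (p w - w))\<^sup>2) / (2 * \<gamma>)" for w
        using phi[of w u] .
      have "((\<lambda>w. - (((norm (p w - u))\<^sup>2 - (norm (p u - u))\<^sup>2) / (2 * \<gamma>)))
          \<longlongrightarrow> - (((norm (p u - u))\<^sup>2 - (norm (p u - u))\<^sup>2) / (2 * \<gamma>))) (at u)"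
        using p_u \<open>0 < \<gamma>\<close> by (intro tendsto_intros) auto
      then show "((\<lambda>w. - (((norm (p w - u))\<^sup>2 - (norm (p u - u))\<^sup>2) / (2 * \<gamma>))) \<longlongrightarrow> 0) (at u)"
        by simp
      have "((\<lambda>w. ((norm (p u - w))\<^sup>2 - (norm (p w - w))\<^sup>2) / (2 * \<gamma>))
          \<longlongrightarrow> ((norm (p u - u))\<^sup>2 - (norm (p u - u))\<^sup>2) / (2 * \<gamma>)) (at u)"
        using p_u \<open>0 < \<gamma>\<close> by (intro tendsto_intros) auto
      then show "((\<lambda>w. ((norm (p u - w))\<^sup>2 - (norm (p w - w))\<^sup>2) / (2 * \<gamma>)) \<longlongrightarrow> 0) (at u)"
        by simp
    qed
    then show "isCont (\<lambda>u. \<phi> (p u)) u"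
      by (simp add: continuous_at LIM_zero_iff)
  qed
qed

lemma has_derivative_along_segment:
  fixes f :: "'a::euclidean_space \<Rightarrow> real"
  assumes "convex X" "x \<in> X" "y \<in> X"
    and deriv: "\<And>x. x \<in> X \<Longrightarrow> (f has_derivative (\<lambda>h. f' x \<bullet> h)) (at x within X)"
    and \<tau>: "\<tau> \<in> {0..1}"
  shows "((\<lambda>\<tau>. f (y + \<tau> *\<^sub>R (x - y))) has_derivative
    (\<lambda>k. f' (y + \<tau> *\<^sub>R (x - y)) \<bullet> (k *\<^sub>R (x - y)))) (at \<tau> within {0..1})"
proof (rule has_derivative_in_compose2[of X])
  have in_X: "y + \<tau> *\<^sub>R (x - y) \<in> X" if "\<tau> \<in> {0..1}" for \<tau>
    using convexD_alt[OF assms(1,3,2), of \<tau>] that by (simp add: algebra_simps)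
  then show "(\<lambda>\<tau>. y + \<tau> *\<^sub>R (x - y)) ` {0..1} \<subseteq> X" by auto
qed (use \<tau> in \<open>auto intro!: deriv derivative_eq_intros\<close>)

lemma convex_on_above_tangent:
  fixes f :: "'a::euclidean_space \<Rightarrow> real"
  assumes "convex X" "x \<in> X" "y \<in> X" "convex_on X f"
    and deriv: "\<And>x. x \<in> X \<Longrightarrow> (f has_derivative (\<lambda>h. f' x \<bullet> h)) (at x within X)"
  shows "f y + f' y \<bullet> (x - y) \<le> f x"
proof -
  let ?h = "\<lambda>\<tau>. f (y + \<tau> *\<^sub>R (x - y))"
  have "(?h has_derivative (\<lambda>k. f' y \<bullet> (k *\<^sub>R (x - y)))) (at 0 within {0..1})"
    using has_derivative_along_segment[OF assms(1-3) deriv, of 0] by simp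
  then have "(?h has_field_derivative f' y \<bullet> (x - y)) (at 0 within {0..1})"
    by (simp add: has_field_derivative_def mult.commute[of _ "_ \<bullet> _"])
  then have "((\<lambda>\<tau>. (?h \<tau> - ?h 0) / (\<tau> - 0)) \<longlongrightarrow> f' y \<bullet> (x - y)) (at_right 0)"
    by (simp add: has_field_derivative_iff at_within_Icc_at_right)
  moreover have "eventually (\<lambda>\<tau>. (?h \<tau> - ?h 0) / (\<tau> - 0) \<le> f x - f y) (at_right 0)"
    unfolding eventually_at_right_field
  proof (intro exI[of _ 1] conjI allI impI)
    fix \<tau> :: real assume \<tau>: "0 < \<tau>" "\<tau> < 1"
    have "?h \<tau> \<le> (1 - \<tau>) * f y + \<tau> * f x"
      using convex_onD[OF \<open>convex_on X f\<close>, of \<tau> y x] assms(2,3) \<tau> by (simp add: algebra_simps)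
    then show "(?h \<tau> - ?h 0) / (\<tau> - 0) \<le> f x - f y" using \<tau> by (simp add: field_simps)
  qed simp
  ultimately have "f' y \<bullet> (x - y) \<le> f x - f y"
    by (intro tendsto_upperbound[where F = "at_right 0"]) auto
  then show ?thesis by simp
qed

text \<open>The mean value theorem along the segment from \<open>y\<close> to \<open>x\<close>, applied to the difference of \<open>f\<close> and its
quadratic upper model: the Lipschitz bound makes the derivative of this difference nonpositive.\<close>

lemma descent_lemma:
  fixes f :: "'a::euclidean_space \<Rightarrow> real"
  assumes "convex X" "x \<in> X" "y \<in> X"
    and deriv: "\<And>x. x \<in> X \<Longrightarrow> (f has_derivative (\<lambda>h. f' x \<bullet> h)) (at x within X)"
    and lip: "\<And>x y. \<lbrakk>x \<in> X; y \<in> X\<rbrakk> \<Longrightarrow> norm (f' x - f' y) \<le> L * norm (x - y)"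
  shows "f x \<le> f y + f' y \<bullet> (x - y) + L / 2 * (norm (x - y))\<^sup>2"
proof -
  let ?d = "x - y"
  let ?h = "\<lambda>\<tau>. f (y + \<tau> *\<^sub>R ?d) - \<tau> * (f' y \<bullet> ?d) - L / 2 * \<tau>\<^sup>2 * (norm ?d)\<^sup>2"
  have "\<exists>\<tau>\<in>{0..1}. ?h 1 - ?h 0 = (\<lambda>k. f' (y + \<tau> *\<^sub>R ?d) \<bullet> (k *\<^sub>R ?d) - k * (f' y \<bullet> ?d)
      - L * \<tau> * k * (norm ?d)\<^sup>2) (1 - 0)"
    by (intro mvt_very_simple)
      (auto intro!: derivative_eq_intros has_derivative_along_segment[OF assms(1-3) deriv])
  then obtain \<tau> where \<tau>: "\<tau> \<in> {0..1}" and eq: "?h 1 - ?h 0 =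
      f' (y + \<tau> *\<^sub>R ?d) \<bullet> ?d - f' y \<bullet> ?d - L * \<tau> * (norm ?d)\<^sup>2"
    by auto
  have in_X: "y + \<tau> *\<^sub>R ?d \<in> X"
    using convexD_alt[OF assms(1,3,2), of \<tau>] \<tau> by (simp add: algebra_simps)
  have "f' (y + \<tau> *\<^sub>R ?d) \<bullet> ?d - f' y \<bullet> ?d \<le> norm (f' (y + \<tau> *\<^sub>R ?d) - f' y) * norm ?d"
    using norm_cauchy_schwarz[of "f' (y + \<tau> *\<^sub>R ?d) - f' y" ?d] by (simp add: inner_diff_left)
  also have "\<dots> \<le> (L * (\<tau> * norm ?d)) * norm ?d"
    using lip[OF in_X assms(3)] \<tau> by (intro mult_right_mono) auto
  finally have "?h 1 - ?h 0 \<le> 0"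
    unfolding eq by (simp add: power2_eq_square mult_ac)
  then show ?thesis by simp
qed

text \<open>The three-point inequality for the model with the inexact gradient \<open>G\<close>, combined with the upper
quadratic bound on \<open>f\<close> at \<open>z\<close> and the lower linear bound on \<open>f\<close> at \<open>x\<close>. The error \<open>G - f' y\<close> pairs
with \<open>x - y\<close>, which does not depend on \<open>G\<close>, and with \<open>y - z\<close>, which does; Young's inequality
absorbs the second pairing in the slack \<open>1 / \<gamma> - L\<close> of the stepsize.\<close>

lemma noisy_prox_step:
  fixes f :: "'a::euclidean_space \<Rightarrow> real"
  assumes "convex X" "convex_on X f"
    and deriv: "\<And>x. x \<in> X \<Longrightarrow> (f has_derivative (\<lambda>h. f' x \<bullet> h)) (at x within X)"
    and lip: "\<And>x y. \<lbrakk>x \<in> X; y \<in> X\<rbrakk> \<Longrightarrow> norm (f' x - f' y) \<le> L * norm (x - y)"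
    and "convex_on X \<phi>" and \<gamma>: "0 < \<gamma>" "L < 1 / \<gamma>"
    and min: "is_arg_min (prox_model c \<phi> \<gamma> y G) (\<lambda>x. x \<in> X) z"
    and y: "y \<in> X" and x: "x \<in> X"
  shows "f z + \<phi> z - (f x + \<phi> x) \<le> (G - f' y) \<bullet> (x - y)
    + (norm (G - f' y))\<^sup>2 / (2 * (1 / \<gamma> - L))
    + 1 / (2 * \<gamma>) * ((norm (x - y))\<^sup>2 - (norm (x - z))\<^sup>2)"
proof -
  define e where "e = 1 / \<gamma> - L"
  have e: "0 < e" using \<gamma> by (simp add: e_def)
  have z: "z \<in> X" using min by (simp add: is_arg_min_linorder)
  let ?w = "G - f' y"
  have "0 \<le> (norm (?w - e *\<^sub>R (y - z)))\<^sup>2" by simp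
  also have "\<dots> = (norm ?w)\<^sup>2 - 2 * e * (?w \<bullet> (y - z)) + e\<^sup>2 * (norm (z - y))\<^sup>2"
    unfolding power2_norm_eq_inner
    by (simp add: inner_diff inner_add algebra_simps inner_commute power2_eq_square)
  finally have young: "?w \<bullet> (y - z) \<le> (norm ?w)\<^sup>2 / (2 * e) + e / 2 * (norm (z - y))\<^sup>2"
    using e by (simp add: field_simps power2_eq_square)
  have split: "1 / (2 * \<gamma>) * (norm (z - y))\<^sup>2 = (L / 2 + e / 2) * (norm (z - y))\<^sup>2"
    by (simp add: e_def flip: add_divide_distrib)
  have inner: "?w \<bullet> (x - y) + ?w \<bullet> (y - z)
      = G \<bullet> (x - y) - G \<bullet> (z - y) - f' y \<bullet> (x - y) + f' y \<bullet> (z - y)"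
    by (simp add: inner_diff algebra_simps)
  have "f z \<le> f y + f' y \<bullet> (z - y) + L / 2 * (norm (z - y))\<^sup>2"
    by (rule descent_lemma[OF \<open>convex X\<close> z y deriv lip])
  moreover have "f y + f' y \<bullet> (x - y) \<le> f x"
    by (rule convex_on_above_tangent[OF \<open>convex X\<close> x y \<open>convex_on X f\<close> deriv])
  moreover have "prox_model c \<phi> \<gamma> y G z + 1 / (2 * \<gamma>) * (norm (x - z))\<^sup>2 \<le> prox_model c \<phi> \<gamma> y G x"
    by (rule prox_three_point[OF \<open>convex X\<close> \<open>convex_on X \<phi>\<close> \<open>0 < \<gamma>\<close> min x])
  ultimately show ?thesis
    using young split inner unfolding prox_model_def e_def[symmetric]
    by (simp only: right_diff_distrib distrib_right)
qed

text \<open>The proximal step is compared with the convex combination \<open>p\<close> of the previous iterate \<open>z'\<close> and the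
reference point \<open>x\<close> with weight \<open>1 / \<beta>\<close> on \<open>x\<close>. The extrapolation is chosen exactly such that
\<open>p - y\<close> and \<open>p - z\<close>, scaled by \<open>\<beta>\<close>, are \<open>x - s'\<close> and \<open>x - s\<close>, so the squared distances telescope.\<close>

lemma accelerated_potential_step:
  fixes f :: "'a::euclidean_space \<Rightarrow> real"
  assumes "convex X" "convex_on X f"
    and deriv: "\<And>x. x \<in> X \<Longrightarrow> (f has_derivative (\<lambda>h. f' x \<bullet> h)) (at x within X)"
    and lip: "\<And>x y. \<lbrakk>x \<in> X; y \<in> X\<rbrakk> \<Longrightarrow> norm (f' x - f' y) \<le> L * norm (x - y)"
    and "convex_on X \<phi>" and \<gamma>: "0 < \<gamma>" "L < 1 / \<gamma>"
    and min: "is_arg_min (prox_model c \<phi> \<gamma> y G) (\<lambda>x. x \<in> X) z"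
    and X: "y \<in> X" "z' \<in> X" "x \<in> X" and \<beta>: "1 \<le> \<beta>"
    and y_eq: "\<beta> *\<^sub>R y = (\<beta> - 1) *\<^sub>R z' + s'"
    and s_eq: "s = z + (\<beta> - 1) *\<^sub>R (z - z')"
  shows "2 * \<gamma> * \<beta>\<^sup>2 * (f z + \<phi> z - (f x + \<phi> x)) + (norm (s - x))\<^sup>2
    \<le> 2 * \<gamma> * (\<beta>\<^sup>2 - \<beta>) * (f z' + \<phi> z' - (f x + \<phi> x)) + (norm (s' - x))\<^sup>2
      + 2 * \<gamma> * \<beta> * ((G - f' y) \<bullet> (x - s')) + \<gamma> * \<beta>\<^sup>2 / (1 / \<gamma> - L) * (norm (G - f' y))\<^sup>2"
proof -
  define p where "p = (1 - 1 / \<beta>) *\<^sub>R z' + (1 / \<beta>) *\<^sub>R x"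
  define e where "e = 1 / \<gamma> - L"
  have e: "0 < e" using \<gamma> by (simp add: e_def)
  have p: "p \<in> X"
    unfolding p_def using X \<beta> by (intro convexD_alt[OF \<open>convex X\<close>]) auto
  have "f p \<le> (1 - 1 / \<beta>) * f z' + 1 / \<beta> * f x" "\<phi> p \<le> (1 - 1 / \<beta>) * \<phi> z' + 1 / \<beta> * \<phi> x"
    unfolding p_def using X \<beta> convex_onD[OF \<open>convex_on X f\<close>, of "1 / \<beta>" z' x]
      convex_onD[OF \<open>convex_on X \<phi>\<close>, of "1 / \<beta>" z' x] by auto
  then have "f p + \<phi> p - (f x + \<phi> x) \<le> (1 - 1 / \<beta>) * (f z' + \<phi> z' - (f x + \<phi> x))"
    by (simp add: algebra_simps)
  then have "2 * \<gamma> * \<beta>\<^sup>2 * (f p + \<phi> p - (f x + \<phi> x))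
      \<le> 2 * \<gamma> * \<beta>\<^sup>2 * ((1 - 1 / \<beta>) * (f z' + \<phi> z' - (f x + \<phi> x)))"
    using \<gamma> by (intro mult_left_mono) auto
  also have "\<dots> = 2 * \<gamma> * (\<beta>\<^sup>2 - \<beta>) * (f z' + \<phi> z' - (f x + \<phi> x))"
    using \<beta> by (simp add: field_simps power2_eq_square)
  finally have conv: "2 * \<gamma> * \<beta>\<^sup>2 * (f p + \<phi> p - (f x + \<phi> x))
      \<le> 2 * \<gamma> * (\<beta>\<^sup>2 - \<beta>) * (f z' + \<phi> z' - (f x + \<phi> x))" .
  have bp: "\<beta> *\<^sub>R p = (\<beta> - 1) *\<^sub>R z' + x"
    using \<beta> by (simp only: p_def scaleR_add_right scaleR_scaleR) (simp add: right_diff_distrib)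
  have py: "\<beta> *\<^sub>R (p - y) = x - s'"
    by (simp add: scaleR_diff_right bp y_eq)
  have pz: "\<beta> *\<^sub>R (p - z) = x - s"
    by (simp add: scaleR_diff_right bp s_eq) (simp add: algebra_simps)
  have norms: "\<beta>\<^sup>2 * (norm (p - y))\<^sup>2 = (norm (s' - x))\<^sup>2" "\<beta>\<^sup>2 * (norm (p - z))\<^sup>2 = (norm (s - x))\<^sup>2"
    using arg_cong[OF py, of "\<lambda>v. (norm v)\<^sup>2"] arg_cong[OF pz, of "\<lambda>v. (norm v)\<^sup>2"]
    by (simp_all add: power_mult_distrib norm_minus_commute)
  have inner: "\<beta> * ((G - f' y) \<bullet> (p - y)) = (G - f' y) \<bullet> (x - s')"
    using arg_cong[OF py, of "\<lambda>v. (G - f' y) \<bullet> v"] by simp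
  have "2 * \<gamma> * \<beta>\<^sup>2 * (f z + \<phi> z - (f p + \<phi> p)) \<le> 2 * \<gamma> * \<beta>\<^sup>2 * ((G - f' y) \<bullet> (p - y)
      + (norm (G - f' y))\<^sup>2 / (2 * e) + 1 / (2 * \<gamma>) * ((norm (p - y))\<^sup>2 - (norm (p - z))\<^sup>2))"
    using noisy_prox_step[OF assms(1,2) deriv lip \<open>convex_on X \<phi>\<close> \<gamma> min X(1) p] \<gamma>
    by (intro mult_left_mono) (auto simp: e_def)
  also have "\<dots> = 2 * \<gamma> * \<beta> * (\<beta> * ((G - f' y) \<bullet> (p - y))) + \<gamma> * \<beta>\<^sup>2 / e * (norm (G - f' y))\<^sup>2
      + (\<beta>\<^sup>2 * (norm (p - y))\<^sup>2 - \<beta>\<^sup>2 * (norm (p - z))\<^sup>2)"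
    using \<gamma> e by (simp add: field_simps power2_eq_square)
  finally have step: "2 * \<gamma> * \<beta>\<^sup>2 * (f z + \<phi> z - (f p + \<phi> p)) \<le>
      2 * \<gamma> * \<beta> * ((G - f' y) \<bullet> (x - s')) + \<gamma> * \<beta>\<^sup>2 / e * (norm (G - f' y))\<^sup>2
      + ((norm (s' - x))\<^sup>2 - (norm (s - x))\<^sup>2)"
    unfolding norms inner .
  have "2 * \<gamma> * \<beta>\<^sup>2 * (f z + \<phi> z - (f x + \<phi> x)) =
      2 * \<gamma> * \<beta>\<^sup>2 * (f z + \<phi> z - (f p + \<phi> p)) + 2 * \<gamma> * \<beta>\<^sup>2 * (f p + \<phi> p - (f x + \<phi> x))"
    by (simp add: algebra_simps)
  then show ?thesis using step conv unfolding e_def by linarith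
qed

lemma norm_sq_convex_combination:
  fixes u v :: "'a::real_inner"
  assumes "0 \<le> \<tau>" "\<tau> \<le> 1"
  shows "(norm ((1 - \<tau>) *\<^sub>R u + \<tau> *\<^sub>R v))\<^sup>2 \<le> (1 - \<tau>) * (norm u)\<^sup>2 + \<tau> * (norm v)\<^sup>2"
proof -
  have "(norm ((1 - \<tau>) *\<^sub>R u + \<tau> *\<^sub>R v))\<^sup>2
      = (1 - \<tau>) * (norm u)\<^sup>2 + \<tau> * (norm v)\<^sup>2 - \<tau> * (1 - \<tau>) * (norm (u - v))\<^sup>2"
    unfolding power2_norm_eq_inner
    by (simp add: inner_diff inner_add algebra_simps inner_commute power2_eq_square)
  then show ?thesis using assms by (simp add: mult_nonneg_nonneg)
qed

section \<open>Sums and asymptotics of the batch sizes\<close>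

text \<open>The integral comparison for \<open>1 / (x (ln x) powr (1 + p))\<close>, whose antiderivative is
\<open>- (ln x) powr (- p) / p\<close>; the mean value theorem replaces the integral.\<close>

lemma sum_inverse_mult_ln_powr_le:
  fixes c p :: real
  assumes c: "1 < c" and p: "0 < p"
  shows "(\<Sum>i = 1..n. 1 / ((real i + c) * ln (real i + c) powr (1 + p)))
    \<le> (ln c powr (- p) - ln (real n + c) powr (- p)) / p"
proof (induction n)
  case 0
  then show ?case by simp
next
  case (Suc n)
  define x where "x = real n + c"
  have x: "1 < x" using c by (simp add: x_def)
  let ?F = "\<lambda>u. - (ln u powr (- p)) / p" and ?F' = "\<lambda>u. 1 / (u * ln u powr (1 + p))"
  have "(?F has_real_derivative ?F' u) (at u)" if "x \<le> u" "u \<le> x + 1" for u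
    using that x p
    by (auto intro!: derivative_eq_intros simp: powr_diff powr_minus powr_add field_simps)
  from MVT2[OF _ this, of x "x + 1"] obtain u where u: "x < u" "u < x + 1"
    and eq: "?F (x + 1) - ?F x = (x + 1 - x) * ?F' u" by auto
  have "?F' (x + 1) \<le> ?F' u"
    using u x p by (intro divide_left_mono mult_mono powr_mono2) auto
  also have "\<dots> = (ln x powr (- p) - ln (x + 1) powr (- p)) / p"
    using eq by (simp add: diff_divide_distrib)
  finally show ?case
    using Suc.IH by (simp add: x_def diff_divide_distrib add.commute add.left_commute)
qed

lemma sum_weight_over_batch_le:
  fixes c p :: real and N :: "nat \<Rightarrow> nat"
  assumes c: "1 < c" and p: "0 < p"
    and N: "\<And>i. 1 \<le> i \<Longrightarrow> (real i + c) ^ 3 * ln (real i + c) powr (1 + p) \<le> real (N i)"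
  shows "(\<Sum>i = 1..n. ((1 + real i) / 2)\<^sup>2 / real (N i)) \<le> ln c powr (- p) / p"
proof -
  have "((1 + real i) / 2)\<^sup>2 / real (N i) \<le> 1 / ((real i + c) * ln (real i + c) powr (1 + p))"
    if "i \<in> {1..n}" for i
  proof -
    let ?x = "real i + c"
    have x: "1 < ?x" using c by simp
    have "((1 + real i) / 2)\<^sup>2 / real (N i) \<le> ?x\<^sup>2 / (?x ^ 3 * ln ?x powr (1 + p))"
      using c x that N[of i] by (intro frac_le power_mono) auto
    also have "\<dots> = 1 / (?x * ln ?x powr (1 + p))"
      using x by (simp add: power2_eq_square power3_eq_cube)
    finally show ?thesis .
  qed
  then have "(\<Sum>i = 1..n. ((1 + real i) / 2)\<^sup>2 / real (N i))
      \<le> (\<Sum>i = 1..n. 1 / ((real i + c) * ln (real i + c) powr (1 + p)))"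
    by (rule sum_mono)
  also have "\<dots> \<le> (ln c powr (- p) - ln (real n + c) powr (- p)) / p"
    by (rule sum_inverse_mult_ln_powr_le[OF c p])
  also have "\<dots> \<le> ln c powr (- p) / p"
    using p by (intro divide_right_mono) auto
  finally show ?thesis .
qed

text \<open>All \<open>n\<close> batches are bounded by the last one. From \<open>3 \<le> i + c\<close> the logarithm is at least 1, so the
rounding up costs at most a factor of 2.\<close>

lemma sum_batch_le:
  fixes c p :: real
  assumes c: "2 \<le> c" and p: "0 \<le> p"
    and N: "\<And>i. 1 \<le> i \<Longrightarrow> N i = N0 * nat \<lceil>(real i + c) ^ 3 * ln (real i + c) powr p\<rceil>"
  shows "(\<Sum>i = 1..n. real (N i)) \<le> 2 * real N0 * (real n + c) ^ 4 * ln (real n + c) powr p"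
proof -
  let ?h = "\<lambda>i. (real i + c) ^ 3 * ln (real i + c) powr p"
  have "real (N i) \<le> 2 * real N0 * ?h n" if "i \<in> {1..n}" for i
  proof -
    have i: "1 \<le> i" "3 \<le> real i + c" "i \<le> n" using that c by auto
    have ln1: "1 \<le> ln (real i + c)"
      using i(2) exp_le by (subst ln_ge_iff) linarith+
    have "1 * 1 \<le> ?h i"
      using i(2) by (intro mult_mono one_le_power ge_one_powr_ge_zero[OF ln1 p]) auto
    moreover have "real (nat \<lceil>h\<rceil>) \<le> 2 * h" if "1 * 1 \<le> h" for h :: real
      using that by linarith
    ultimately have "real (nat \<lceil>?h i\<rceil>) \<le> 2 * ?h i" by blast
    also have "\<dots> \<le> 2 * ?h n"
      using i ln1 p c by (intro mult_left_mono mult_mono power_mono powr_mono2) auto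
    finally have "real N0 * real (nat \<lceil>?h i\<rceil>) \<le> real N0 * (2 * ?h n)"
      by (intro mult_left_mono) auto
    then show ?thesis unfolding N[OF i(1)] by (simp add: mult_ac)
  qed
  then have "(\<Sum>i = 1..n. real (N i)) \<le> (\<Sum>i = 1..n. 2 * real N0 * ?h n)"
    by (rule sum_mono)
  also have "\<dots> = real n * (2 * real N0 * ?h n)" by simp
  also have "\<dots> \<le> (real n + c) * (2 * real N0 * ?h n)"
    using c by (intro mult_right_mono mult_nonneg_nonneg) auto
  also have "\<dots> = 2 * real N0 * (real n + c) ^ 4 * ln (real n + c) powr p"
    by (simp add: power4_eq_xxxx power3_eq_cube)
  finally show ?thesis .
qed

lemma eventually_powr_neg_ge_at_right_0:
  fixes k q :: real
  assumes "0 < q"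
  shows "eventually (\<lambda>\<epsilon>. k \<le> \<epsilon> powr (- q)) (at_right 0)"
proof -
  define b where "b = max k 1 powr (- 1 / q)"
  have b: "0 < b" "b powr (- q) = max k 1"
    using assms by (simp_all add: b_def powr_powr)
  have "k \<le> \<epsilon> powr (- q)" if "0 < \<epsilon>" "\<epsilon> < b" for \<epsilon>
    using powr_mono2'[of "- q" \<epsilon> b] that assms b by simp
  then show ?thesis
    using b(1) by (auto simp: eventually_at_right_field)
qed

text \<open>With \<open>e = \<epsilon> powr (- 1 / 2)\<close>, the quantity \<open>T \<epsilon> + c\<close> is at most \<open>E e\<close> for a constant \<open>E\<close>. As soon as
\<open>E \<le> e\<close>, the logarithm of \<open>E e\<close> is at most twice that of \<open>e\<close>; as soon as \<open>3 \<le> e\<close>, the latter is at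
least 1 and its power may be enlarged from \<open>p\<close> to \<open>q\<close>.\<close>

lemma power4_mult_ln_powr_bigo:
  fixes T :: "real \<Rightarrow> nat" and S :: "nat \<Rightarrow> real" and c p q A :: real
  assumes T: "(\<lambda>\<epsilon>. real (T \<epsilon>)) \<in> O[at_right 0](\<lambda>\<epsilon>. \<epsilon> powr (- 1 / 2))"
    and c: "1 \<le> c" and p: "0 \<le> p" "p \<le> q" and A: "0 \<le> A"
    and S: "\<And>n. 0 \<le> S n" "\<And>n. S n \<le> A * (real n + c) ^ 4 * ln (real n + c) powr p"
  shows "(\<lambda>\<epsilon>. S (T \<epsilon>)) \<in> O[at_right 0](\<lambda>\<epsilon>. \<epsilon> powr (- 2) * ln (\<epsilon> powr (- 1 / 2)) powr q)"
proof -
  obtain D where D: "0 < D"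
    and ev_T: "eventually (\<lambda>\<epsilon>. norm (real (T \<epsilon>)) \<le> D * norm (\<epsilon> powr (- 1 / 2))) (at_right 0)"
    using T by (elim landau_o.bigE)
  define E where "E = D + c"
  have ev_e: "eventually (\<lambda>\<epsilon>::real. max 3 E \<le> \<epsilon> powr (- 1 / 2)) (at_right 0)"
    using eventually_powr_neg_ge_at_right_0[of "1 / 2" "max 3 E"] by simp
  show ?thesis
  proof (rule bigoI)
    show "eventually (\<lambda>\<epsilon>. norm (S (T \<epsilon>)) \<le> (A * E ^ 4 * 2 powr p)
        * norm (\<epsilon> powr (- 2) * ln (\<epsilon> powr (- 1 / 2)) powr q)) (at_right 0)"
      using ev_T ev_e eventually_at_right_less
    proof eventually_elim
      case (elim \<epsilon>)
      define e where "e = \<epsilon> powr (- 1 / 2)"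
      have e: "3 \<le> e" "E \<le> e" and Te: "real (T \<epsilon>) \<le> D * e"
        using elim by (simp_all add: e_def)
      have E: "1 < E" using D c by (simp add: E_def)
      have e4: "e ^ 4 = \<epsilon> powr (- 2)"
        using \<open>0 < \<epsilon>\<close> by (simp add: e_def powr_powr flip: powr_realpow)
      have ln_e: "1 \<le> ln e" using e(1) exp_le by (subst ln_ge_iff) linarith+
      have "c * 1 \<le> c * e" using c e(1) by (intro mult_left_mono) auto
      then have Tc: "real (T \<epsilon>) + c \<le> E * e" using Te by (simp add: E_def distrib_right)
      have "ln (real (T \<epsilon>) + c) \<le> ln (E * e)" using Tc c by simp
      also have "\<dots> \<le> 2 * ln e" using E e by (simp add: ln_mult)
      finally have ln_Tc: "ln (real (T \<epsilon>) + c) \<le> 2 * ln e" .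
      have "S (T \<epsilon>) \<le> A * (real (T \<epsilon>) + c) ^ 4 * ln (real (T \<epsilon>) + c) powr p" by (rule S(2))
      also have "\<dots> \<le> A * (E * e) ^ 4 * (2 * ln e) powr p"
        using A Tc ln_Tc c p(1) by (intro mult_mono power_mono powr_mono2 mult_nonneg_nonneg) auto
      also have "\<dots> = A * E ^ 4 * 2 powr p * (e ^ 4 * ln e powr p)"
        using ln_e by (simp add: power_mult_distrib powr_mult)
      also have "\<dots> \<le> A * E ^ 4 * 2 powr p * (e ^ 4 * ln e powr q)"
        using A p(2) ln_e E by (intro mult_left_mono powr_mono) auto
      finally show ?case using S(1) e4 by (simp add: e_def)
    qed
  qed
qed

section \<open>Independence from the past\<close>

text \<open>The \<open>\<sigma>\<close>-algebra generated by the random variables with index in \<open>A\<close>, as a measurable space on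
\<open>space M\<close>: what is known once these draws have been made.\<close>

definition history ::
  "'w measure \<Rightarrow> 's measure \<Rightarrow> ('i \<Rightarrow> 'w \<Rightarrow> 's) \<Rightarrow> 'i set \<Rightarrow> 'w measure" where
  "history M P \<Xi> A = sigma (space M) (\<Union>i\<in>A. {\<Xi> i -` B \<inter> space M | B. B \<in> sets P})"

lemma space_history [simp]: "space (history M P \<Xi> A) = space M"
  by (simp add: history_def space_measure_of_conv)

lemma sets_history:
  "sets (history M P \<Xi> A) = sigma_sets (space M) (\<Union>i\<in>A. {\<Xi> i -` B \<inter> space M | B. B \<in> sets P})"
  unfolding history_def by (rule sets_measure_of) auto

lemma measurable_history_mono:
  assumes "A \<subseteq> B" "U \<in> measurable (history M P \<Xi> A) S"
  shows "U \<in> measurable (history M P \<Xi> B) S"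
proof -
  have "sets (history M P \<Xi> A) \<subseteq> sets (history M P \<Xi> B)"
    unfolding sets_history using assms(1) by (intro sigma_sets_mono') blast
  then show ?thesis using assms(2) by (auto simp: measurable_def)
qed

lemma measurable_history_draw:
  assumes "\<Xi> i \<in> measurable M P" "i \<in> A"
  shows "\<Xi> i \<in> measurable (history M P \<Xi> A) P"
proof (rule measurableI)
  fix B assume "B \<in> sets P"
  then show "\<Xi> i -` B \<inter> space (history M P \<Xi> A) \<in> sets (history M P \<Xi> A)"
    unfolding sets_history space_history using \<open>i \<in> A\<close> by (intro sigma_sets.Basic) blast
qed (use assms in \<open>auto dest: measurable_space\<close>)

lemma measurable_history_imp_measurable:
  assumes "\<And>i. i \<in> A \<Longrightarrow> \<Xi> i \<in> measurable M P" "U \<in> measurable (history M P \<Xi> A) S"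
  shows "U \<in> measurable M S"
proof -
  have "sets (history M P \<Xi> A) \<subseteq> sets M"
    unfolding sets_history using assms(1)
    by (intro sets.sigma_sets_subset) (auto intro: measurable_sets)
  then show ?thesis using assms(2) by (auto simp: measurable_def)
qed

text \<open>Independence in the form needed for Fubini's theorem. It is stated through the joint distribution
because \<open>indep_var\<close> asks both random variables to take values in the same type.\<close>

lemma (in prob_space) distr_pair_history_draw:
  assumes indep: "indep_vars (\<lambda>_. P) \<Xi> I" and A: "A \<subseteq> I" and k: "k \<in> I - A"
    and U: "U \<in> measurable (history M P \<Xi> A) S"
  shows "distr M (S \<Otimes>\<^sub>M P) (\<lambda>\<omega>. (U \<omega>, \<Xi> k \<omega>)) = distr M S U \<Otimes>\<^sub>M distr M P (\<Xi> k)"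
proof -
  have draws: "\<Xi> i \<in> measurable M P" if "i \<in> I" for i
    using indep that by (simp add: indep_vars_def2)
  let ?E = "\<lambda>i. {\<Xi> i -` B \<inter> space M | B. B \<in> sets P}"
  let ?I = "case_bool A {k}"
  have "indep_sets ?E (\<Union>j\<in>UNIV. ?I j)"
    using indep A k unfolding indep_vars_def2
    by (elim conjE indep_sets_mono_index[rotated]) (auto simp: UNIV_bool)
  moreover have "Int_stable (?E i)" for i
    by (auto simp: Int_stable_def) (metis vimage_Int sets.Int Int_assoc Int_left_commute Int_absorb)
  moreover have "disjoint_family ?I"
    using k by (auto simp: disjoint_family_on_def split: bool.split)
  ultimately have "indep_sets (\<lambda>j. sigma_sets (space M) (\<Union>i\<in>?I j. ?E i)) UNIV"
    by (intro indep_sets_collect_sigma)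
  then have "indep_set (sets (history M P \<Xi> A)) (sigma_sets (space M) (?E k))"
    unfolding indep_set_def sets_history
    by (rule indep_sets_mono_sets) (auto split: bool.split)
  then have prob: "prob (a \<inter> b) = prob a * prob b"
    if "a \<in> sets (history M P \<Xi> A)" "b \<in> ?E k" for a b
    using that by (intro indep_setD) (auto intro: sigma_sets.Basic)
  have U_M [measurable]: "U \<in> measurable M S"
    using measurable_history_imp_measurable[OF _ U] draws A by auto
  have k_M [measurable]: "\<Xi> k \<in> measurable M P" using draws k by auto
  interpret U: prob_space "distr M S U" by (rule prob_space_distr) simp
  interpret k: prob_space "distr M P (\<Xi> k)" by (rule prob_space_distr) simp
  show ?thesis
  proof (rule pair_measure_eqI[symmetric])
    fix B C assume B: "B \<in> sets (distr M S U)" and C: "C \<in> sets (distr M P (\<Xi> k))"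
    have "(\<lambda>\<omega>. (U \<omega>, \<Xi> k \<omega>)) -` (B \<times> C) \<inter> space M = (U -` B \<inter> space M) \<inter> (\<Xi> k -` C \<inter> space M)"
      by auto
    moreover have "prob ((U -` B \<inter> space M) \<inter> (\<Xi> k -` C \<inter> space M))
        = prob (U -` B \<inter> space M) * prob (\<Xi> k -` C \<inter> space M)"
      using measurable_sets[OF U, of B] B C by (intro prob) auto
    ultimately show "emeasure (distr M S U) B * emeasure (distr M P (\<Xi> k)) C
        = emeasure (distr M (S \<Otimes>\<^sub>M P) (\<lambda>\<omega>. (U \<omega>, \<Xi> k \<omega>))) (B \<times> C)"
      using B C by (simp add: emeasure_distr emeasure_eq_measure ennreal_mult')
  qed (auto intro: U.sigma_finite_measure_axioms k.sigma_finite_measure_axioms)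
qed

lemma (in prob_space) nn_integral_product_distr:
  assumes U [measurable]: "U \<in> measurable M S" and V [measurable]: "V \<in> measurable M T"
    and pair: "distr M (S \<Otimes>\<^sub>M T) (\<lambda>\<omega>. (U \<omega>, V \<omega>)) = distr M S U \<Otimes>\<^sub>M distr M T V"
    and h [measurable]: "h \<in> borel_measurable (S \<Otimes>\<^sub>M T)"
  shows "(\<integral>\<^sup>+\<omega>. h (U \<omega>, V \<omega>) \<partial>M) = (\<integral>\<^sup>+\<omega>. (\<integral>\<^sup>+v. h (U \<omega>, v) \<partial>distr M T V) \<partial>M)"
proof -
  interpret V: prob_space "distr M T V" by (rule prob_space_distr) simp
  have h' [measurable]: "h \<in> borel_measurable (S \<Otimes>\<^sub>M distr M T V)" using h by simp
  have "(\<integral>\<^sup>+\<omega>. h (U \<omega>, V \<omega>) \<partial>M) = (\<integral>\<^sup>+x. h x \<partial>distr M (S \<Otimes>\<^sub>M T) (\<lambda>\<omega>. (U \<omega>, V \<omega>)))"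
    by (subst nn_integral_distr) auto
  also have "\<dots> = (\<integral>\<^sup>+x. h x \<partial>(distr M S U \<Otimes>\<^sub>M distr M T V))"
    by (simp add: pair)
  also have "\<dots> = (\<integral>\<^sup>+u. (\<integral>\<^sup>+v. h (u, v) \<partial>distr M T V) \<partial>distr M S U)"
    by (subst V.nn_integral_fst[symmetric]) simp_all
  also have "\<dots> = (\<integral>\<^sup>+\<omega>. (\<integral>\<^sup>+v. h (U \<omega>, v) \<partial>distr M T V) \<partial>M)"
    by (subst nn_integral_distr) (auto intro!: V.borel_measurable_nn_integral_fst)
  finally show ?thesis .
qed

text \<open>Fubini's theorem, integrating over \<open>V\<close> first, replaces conditional expectations throughout.\<close>

lemma (in prob_space) expectation_product_distr_eq_0:
  fixes h :: "_ \<Rightarrow> real"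
  assumes U [measurable]: "U \<in> measurable M S" and V [measurable]: "V \<in> measurable M T"
    and pair: "distr M (S \<Otimes>\<^sub>M T) (\<lambda>\<omega>. (U \<omega>, V \<omega>)) = distr M S U \<Otimes>\<^sub>M distr M T V"
    and h [measurable]: "h \<in> borel_measurable (S \<Otimes>\<^sub>M T)"
    and int: "integrable M (\<lambda>\<omega>. h (U \<omega>, V \<omega>))"
    and centered: "\<And>u. u \<in> space S \<Longrightarrow> (\<integral>v. h (u, v) \<partial>distr M T V) = 0"
  shows "expectation (\<lambda>\<omega>. h (U \<omega>, V \<omega>)) = 0"
proof -
  interpret V: prob_space "distr M T V" by (rule prob_space_distr) simp
  interpret U: prob_space "distr M S U" by (rule prob_space_distr) simp
  interpret UV: pair_sigma_finite "distr M S U" "distr M T V" ..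
  have "integrable (distr M (S \<Otimes>\<^sub>M T) (\<lambda>\<omega>. (U \<omega>, V \<omega>))) h"
    using int by (subst integrable_distr_eq) auto
  then have int': "integrable (distr M S U \<Otimes>\<^sub>M distr M T V) h" by (simp add: pair)
  have "expectation (\<lambda>\<omega>. h (U \<omega>, V \<omega>)) = (\<integral>x. h x \<partial>(distr M S U \<Otimes>\<^sub>M distr M T V))"
    unfolding pair[symmetric] by (subst integral_distr) auto
  also have "\<dots> = (\<integral>u. (\<integral>v. h (u, v) \<partial>distr M T V) \<partial>distr M S U)"
    using UV.integral_fst'[OF int'] by simp
  also have "\<dots> = (\<integral>u. 0 \<partial>distr M S U)"
    by (intro Bochner_Integration.integral_cong) (auto simp: centered)
  finally show ?thesis by simp
qed

section \<open>The iterates as random variables\<close>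

text \<open>One run of the method with a constant stepsize, and a solution \<open>xs\<close> as the reference point. The rates
for specific weights and batch sizes are instances of the bound proved here.\<close>

locale accelerated_method = stochastic_composite_problem P X F dF \<phi> L
  for P :: "'s measure" and X :: "'a::euclidean_space set" and F dF \<phi> L +
  fixes M :: "'w measure" and \<sigma>L \<gamma> :: real and \<alpha> \<beta> :: "nat \<Rightarrow> real" and N :: "nat \<Rightarrow> nat"
    and \<xi> :: "nat \<Rightarrow> nat \<Rightarrow> 'w \<Rightarrow> 's" and x1 xs :: 'a and y z :: "nat \<Rightarrow> 'w \<Rightarrow> 'a"
  assumes noise: "multiplicative_noise P X dF \<sigma>L"
    and run: "accelerated_run M P X F dF \<phi> \<alpha> \<beta> N \<xi> x1 y z"
    and constant_step: "1 \<le> t \<Longrightarrow> \<alpha> t = \<gamma>"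
    and \<gamma>_pos: "0 < \<gamma>" and \<gamma>_less: "L < 1 / \<gamma>"
    and \<beta>_1: "\<beta> 1 = 1"
    and \<beta>_ge_1: "1 \<le> t \<Longrightarrow> 1 \<le> \<beta> t"
    and \<beta>_step: "1 \<le> t \<Longrightarrow> (\<beta> (t + 1))\<^sup>2 - \<beta> (t + 1) \<le> (\<beta> t)\<^sup>2"
    and N_pos: "1 \<le> t \<Longrightarrow> 1 \<le> N t"
    and xs_solution: "xs \<in> solution_set X (composite_objective P F \<phi>)"
begin

abbreviation "f \<equiv> mean_objective P F"
abbreviation "f' \<equiv> mean_gradient P dF"
abbreviation "g \<equiv> composite_objective P F \<phi>"
abbreviation "G t \<omega> \<equiv> minibatch_gradient dF (N t) (\<lambda>j. \<xi> t j \<omega>) (y t \<omega>)"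
abbreviation "draw \<equiv> \<lambda>(t, j). \<xi> t j"

definition draws_until :: "nat \<Rightarrow> (nat \<times> nat) set" where
  "draws_until t = {(s, j). 1 \<le> s \<and> s \<le> t \<and> 1 \<le> j \<and> j \<le> N s}"

abbreviation "past t \<equiv> history M P draw (draws_until t)"

sublocale M: prob_space M
  using run by (simp add: accelerated_run_def)

lemma xs_in_X: "xs \<in> X" and g_min: "x \<in> X \<Longrightarrow> g xs \<le> g x"
  using xs_solution by (auto simp: solution_set_def is_arg_min_linorder)

lemma optimal_value_eq: "optimal_value X g = g xs"
  unfolding optimal_value_def using xs_in_X g_min by (intro cInf_eq_minimum) auto

lemma run_simps:
  assumes "\<omega> \<in> space M"
  shows "y 1 \<omega> = x1" "z 0 \<omega> = x1" "x1 \<in> X"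
    and "1 \<le> t \<Longrightarrow> y t \<omega> \<in> X"
    and "1 \<le> t \<Longrightarrow> is_arg_min (prox_model (f (y t \<omega>)) \<phi> \<gamma> (y t \<omega>) (G t \<omega>)) (\<lambda>x. x \<in> X) (z t \<omega>)"
    and "1 \<le> t \<Longrightarrow> y (t + 1) \<omega> = ((\<beta> t - 1) / \<beta> (t + 1)) *\<^sub>R (z t \<omega> - z (t - 1) \<omega>) + z t \<omega>"
  using run assms constant_step[of t] unfolding accelerated_run_def by auto

lemma z_in_X: "\<omega> \<in> space M \<Longrightarrow> z t \<omega> \<in> X"
  using run_simps(2,3)[of \<omega>] run_simps(5)[of \<omega> t] by (cases t) (auto simp: is_arg_min_linorder)

lemma draws_indep: "M.indep_vars (\<lambda>_. P) draw {(t, j). 1 \<le> t \<and> 1 \<le> j \<and> j \<le> N t}"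
  using run by (simp add: accelerated_run_def)

lemma draw_measurable: "1 \<le> t \<Longrightarrow> j \<in> {1..N t} \<Longrightarrow> \<xi> t j \<in> measurable M P"
  using draws_indep by (force simp: M.indep_vars_def2)

lemma draw_distr: "1 \<le> t \<Longrightarrow> j \<in> {1..N t} \<Longrightarrow> distr M P (\<xi> t j) = P"
  using run by (simp add: accelerated_run_def)

lemma past_imp_measurable: "U \<in> measurable (past t) S \<Longrightarrow> U \<in> measurable M S"
  by (rule measurable_history_imp_measurable) (auto simp: draws_until_def intro: draw_measurable)

text \<open>Besides the earlier iterations, \<open>A\<close> may contain other draws of the current batch. This is what makes
two draws of one batch uncorrelated, although both are evaluated at the same random point \<open>y t\<close>.\<close>

lemma
  assumes t: "1 \<le> t" and j: "j \<in> {1..N t}" and A: "A \<subseteq> draws_until t - {(t, j)}"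
    and U: "U \<in> measurable (history M P draw A) S"
  shows measurable_before_draw: "U \<in> measurable M S"
    and distr_pair_draw: "distr M (S \<Otimes>\<^sub>M P) (\<lambda>\<omega>. (U \<omega>, \<xi> t j \<omega>)) = distr M S U \<Otimes>\<^sub>M P"
proof -
  show "U \<in> measurable M S"
    using A by (intro past_imp_measurable[of _ t] measurable_history_mono[OF _ U]) auto
  have "A \<subseteq> {(t, j). 1 \<le> t \<and> 1 \<le> j \<and> j \<le> N t}" "(t, j) \<notin> A"
    using A by (auto simp: draws_until_def)
  then show "distr M (S \<Otimes>\<^sub>M P) (\<lambda>\<omega>. (U \<omega>, \<xi> t j \<omega>)) = distr M S U \<Otimes>\<^sub>M P"
    using M.distr_pair_history_draw[OF draws_indep, of A "(t, j)" U S] U t j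
    by (simp add: draw_distr)
qed

lemma f_measurable: "f \<in> borel_measurable (restrict_space borel X)"
  by (intro borel_measurable_continuous_on_restrict has_derivative_continuous_on[OF f_gradient])

lemma f'_measurable: "f' \<in> borel_measurable (restrict_space borel X)"
proof (intro borel_measurable_continuous_on_restrict lipschitz_on_continuous_on)
  show "L-lipschitz_on X f'"
    using gradient_Lipschitz L_pos by (intro lipschitz_onI) (auto simp: dist_norm)
qed

lemma dF_compose_measurable:
  assumes "Y \<in> borel_measurable S" "\<And>\<omega>. \<omega> \<in> space S \<Longrightarrow> Y \<omega> \<in> X" "V \<in> measurable S P"
  shows "(\<lambda>\<omega>. dF (Y \<omega>) (V \<omega>)) \<in> borel_measurable S"
proof -
  have "(\<lambda>\<omega>. (Y \<omega>, V \<omega>)) \<in> measurable S (restrict_space borel X \<Otimes>\<^sub>M P)"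
    using assms by (intro measurable_Pair measurable_restrict_space2) auto
  from measurable_compose[OF this dF_measurable] show ?thesis by simp
qed

lemma X_compose_measurable:
  assumes "h \<in> borel_measurable (restrict_space borel X)"
    and "Y \<in> borel_measurable S" "\<And>\<omega>. \<omega> \<in> space S \<Longrightarrow> Y \<omega> \<in> X"
  shows "(\<lambda>\<omega>. h (Y \<omega>)) \<in> borel_measurable S"
  using assms(2,3) by (intro measurable_compose[OF _ assms(1)] measurable_restrict_space2) auto

definition prox_point :: "'a \<Rightarrow> 'a" where
  "prox_point u = (SOME x. is_arg_min (prox_model 0 \<phi> \<gamma> u 0) (\<lambda>x. x \<in> X) x)"

lemma prox_point: "is_arg_min (prox_model 0 \<phi> \<gamma> u 0) (\<lambda>x. x \<in> X) (prox_point u)"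
proof -
  \<comment> \<open>The gradient is chosen such that the shifted base point becomes \<open>u\<close>, which may lie outside \<open>X\<close>.\<close>
  obtain x where
    "is_arg_min (prox_model (f xs) \<phi> \<gamma> xs ((1 / \<gamma>) *\<^sub>R (xs - u))) (\<lambda>x. x \<in> X) x"
    using prox_well_defined[OF \<gamma>_pos xs_in_X] by blast
  then have "is_arg_min (prox_model 0 \<phi> \<gamma> u 0) (\<lambda>x. x \<in> X) x"
    using is_arg_min_prox_model_shift[OF \<gamma>_pos, of _ _ xs, where c' = 0] \<gamma>_pos by simp
  then show ?thesis unfolding prox_point_def by (rule someI)
qed

lemma z_eq_prox_point:
  assumes "\<omega> \<in> space M" "1 \<le> t"
  shows "z t \<omega> = prox_point (y t \<omega> - \<gamma> *\<^sub>R G t \<omega>)"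
proof -
  have "is_arg_min (prox_model 0 \<phi> \<gamma> (y t \<omega> - \<gamma> *\<^sub>R G t \<omega>) 0) (\<lambda>x. x \<in> X) (z t \<omega>)"
    using run_simps(5)[OF assms] is_arg_min_prox_model_shift[OF \<gamma>_pos] by blast
  from prox_nonexpansive[OF convex_X \<phi>_convex \<gamma>_pos this
      prox_point[of "y t \<omega> - \<gamma> *\<^sub>R G t \<omega>"]] show ?thesis by simp
qed

lemma minibatch_measurable:
  assumes "Y \<in> borel_measurable S" "\<And>\<omega>. \<omega> \<in> space S \<Longrightarrow> Y \<omega> \<in> X"
    and "\<And>j. j \<in> {1..N t} \<Longrightarrow> \<xi> t j \<in> measurable S P"
  shows "(\<lambda>\<omega>. minibatch_gradient dF (N t) (\<lambda>j. \<xi> t j \<omega>) (Y \<omega>)) \<in> borel_measurable S"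
  unfolding minibatch_gradient_def
  by (intro borel_measurable_scaleR borel_measurable_const borel_measurable_sum
      dF_compose_measurable assms) auto

lemma past_mono: "s \<le> t \<Longrightarrow> U \<in> measurable (past s) S \<Longrightarrow> U \<in> measurable (past t) S"
  by (rule measurable_history_mono) (auto simp: draws_until_def)

lemma draw_past: "1 \<le> t \<Longrightarrow> j \<in> {1..N t} \<Longrightarrow> \<xi> t j \<in> measurable (past t) P"
  using measurable_history_draw[of draw "(t, j)" M P "draws_until t"] draw_measurable[of t j]
  by (auto simp: draws_until_def)

text \<open>The point \<open>y (t + 1)\<close> is known before batch \<open>t + 1\<close> is drawn. The induction needs two
consecutive \<open>z\<close>, as the extrapolation uses both.\<close>

lemma iterates_measurable_past:
  "z t \<in> borel_measurable (past t) \<and> z (t - 1) \<in> borel_measurable (past t)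
    \<and> y (t + 1) \<in> borel_measurable (past t)"
proof (induction t)
  case 0
  have "(\<lambda>\<omega>. x1) \<in> borel_measurable (past 0)" by simp
  moreover have "z 0 \<in> borel_measurable (past 0) \<longleftrightarrow> (\<lambda>\<omega>. x1) \<in> borel_measurable (past 0)"
    "y 1 \<in> borel_measurable (past 0) \<longleftrightarrow> (\<lambda>\<omega>. x1) \<in> borel_measurable (past 0)"
    by (intro measurable_cong; simp add: run_simps run_simps(1)[unfolded One_nat_def])+
  ultimately show ?case by simp
next
  case (Suc t)
  have y_t: "y (Suc t) \<in> borel_measurable (past (Suc t))"
    and z_t: "z t \<in> borel_measurable (past (Suc t))"
    using Suc.IH past_mono[of t "Suc t"] by auto
  have "(\<lambda>\<omega>. y (Suc t) \<omega> - \<gamma> *\<^sub>R G (Suc t) \<omega>) \<in> borel_measurable (past (Suc t))"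
    using run_simps(4)[of _ "Suc t"] draw_past[of "Suc t"]
    by (intro borel_measurable_diff borel_measurable_scaleR borel_measurable_const
        minibatch_measurable y_t) auto
  from borel_measurable_continuous_on[OF continuous_on_prox(1)[OF convex_X \<phi>_convex \<gamma>_pos prox_point] this]
  have z_Suc: "z (Suc t) \<in> borel_measurable (past (Suc t))"
    by (subst measurable_cong[OF z_eq_prox_point]) auto
  have "(\<lambda>\<omega>. ((\<beta> (Suc t) - 1) / \<beta> (Suc t + 1)) *\<^sub>R (z (Suc t) \<omega> - z t \<omega>) + z (Suc t) \<omega>)
      \<in> borel_measurable (past (Suc t))"
    using z_t z_Suc by measurable
  then have "y (Suc t + 1) \<in> borel_measurable (past (Suc t))"
    by (subst measurable_cong[OF run_simps(6)[of _ "Suc t"]]) auto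
  with z_t z_Suc show ?case by simp
qed

lemma z_measurable: "z t \<in> borel_measurable M"
  using iterates_measurable_past[of t] by (blast intro: past_imp_measurable)

lemma y_past: "1 \<le> t \<Longrightarrow> y t \<in> borel_measurable (past (t - 1))"
  using iterates_measurable_past[of "t - 1"] by simp

lemma y_measurable: "1 \<le> t \<Longrightarrow> y t \<in> borel_measurable M"
  by (rule past_imp_measurable[OF y_past])

text \<open>For \<open>t \<ge> 1\<close> the iterate is a proximal point, and \<open>\<phi>\<close> is continuous along these; \<open>\<phi>\<close> itself need not
be Borel measurable.\<close>

lemma g_z_measurable:
  assumes "1 \<le> t"
  shows "(\<lambda>\<omega>. g (z t \<omega>)) \<in> borel_measurable M"
proof -
  have "(\<lambda>\<omega>. y t \<omega> - \<gamma> *\<^sub>R G t \<omega>) \<in> borel_measurable M"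
    using run_simps(4)[OF _ assms] draw_measurable[OF assms]
    by (intro borel_measurable_diff borel_measurable_scaleR borel_measurable_const
        minibatch_measurable y_measurable assms) auto
  from borel_measurable_continuous_on[OF continuous_on_prox(2)[OF convex_X \<phi>_convex \<gamma>_pos prox_point] this]
  have "(\<lambda>\<omega>. \<phi> (z t \<omega>)) \<in> borel_measurable M"
    by (subst measurable_cong[of _ _ "\<lambda>\<omega>. \<phi> (prox_point (y t \<omega> - \<gamma> *\<^sub>R G t \<omega>))"])
      (auto simp: z_eq_prox_point[OF _ assms])
  then show ?thesis
    unfolding composite_objective_def
    by (intro borel_measurable_add X_compose_measurable[OF f_measurable z_measurable] z_in_X)
qed

section \<open>Second moments of the minibatch noise\<close>

definition \<sigma>s :: real where "\<sigma>s = enn2real (noise_sd P dF xs)"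

text \<open>The noise condition between \<open>x\<close> and the solution, squared. The noise at the solution is finite since
it is finite at some point of \<open>X\<close> and grows at most linearly; so \<open>\<sigma>s\<close> is the true standard
deviation there.\<close>

lemma variance_bound:
  assumes "x \<in> X"
  shows "(\<integral>\<^sup>+\<xi>. ennreal ((norm (dF x \<xi> - f' x))\<^sup>2) \<partial>P)
    \<le> ennreal (2 * (\<sigma>s\<^sup>2 + \<sigma>L\<^sup>2 * (norm (x - xs))\<^sup>2))"
proof -
  define v where "v = (\<integral>\<^sup>+\<xi>. ennreal ((norm (dF x \<xi> - f' x))\<^sup>2) \<partial>P)"
  obtain x0 where x0: "x0 \<in> X" "noise_sd P dF x0 < \<infinity>" and "0 < \<sigma>L"
    and le: "\<And>x x'. x \<in> X \<Longrightarrow> x' \<in> X \<Longrightarrow>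
      noise_sd P dF x \<le> noise_sd P dF x' + ennreal (\<sigma>L * norm (x - x'))"
    using noise unfolding multiplicative_noise_def by blast
  have "noise_sd P dF xs \<le> noise_sd P dF x0 + ennreal (\<sigma>L * norm (xs - x0))"
    by (rule le[OF xs_in_X x0(1)])
  also have "\<dots> < \<infinity>" using x0(2) by simp
  finally have "noise_sd P dF xs < \<infinity>" .
  then have sd_xs: "noise_sd P dF xs = ennreal \<sigma>s"
    by (simp add: \<sigma>s_def)
  have \<sigma>s: "0 \<le> \<sigma>s" by (simp add: \<sigma>s_def)
  have sd: "noise_sd P dF x \<le> ennreal (\<sigma>s + \<sigma>L * norm (x - xs))"
    using le[OF assms xs_in_X] \<sigma>s \<open>0 < \<sigma>L\<close> by (simp add: sd_xs ennreal_plus)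
  then have fin: "v \<noteq> \<infinity>"
    by (auto simp: noise_sd_def v_def[symmetric] top_unique)
  then have "sqrt (enn2real v) \<le> \<sigma>s + \<sigma>L * norm (x - xs)"
    using sd \<sigma>s \<open>0 < \<sigma>L\<close>
    by (simp add: noise_sd_def v_def[symmetric] ennreal_le_iff del: ennreal_plus)
  then have "enn2real v \<le> (\<sigma>s + \<sigma>L * norm (x - xs))\<^sup>2"
    by (simp add: sqrt_le_D)
  also have "\<dots> \<le> 2 * (\<sigma>s\<^sup>2 + \<sigma>L\<^sup>2 * (norm (x - xs))\<^sup>2)"
    using sum_squares_bound[of \<sigma>s "\<sigma>L * norm (x - xs)"]
    by (simp add: power2_sum power_mult_distrib)
  finally show ?thesis
    using fin unfolding v_def[symmetric] by (metis ennreal_enn2real_if ennreal_leI infinity_ennreal_def)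
qed

definition \<zeta> :: "nat \<Rightarrow> nat \<Rightarrow> 'w \<Rightarrow> 'a" where
  "\<zeta> t j \<omega> = dF (y t \<omega>) (\<xi> t j \<omega>) - f' (y t \<omega>)"

lemma noise_eq_mean:
  assumes "1 \<le> t"
  shows "G t \<omega> - f' (y t \<omega>) = (1 / real (N t)) *\<^sub>R (\<Sum>j = 1..N t. \<zeta> t j \<omega>)"
  using N_pos[OF assms]
  by (simp add: minibatch_gradient_def \<zeta>_def sum_subtractf scaleR_diff_right sum_constant_scaleR)

lemma \<zeta>_measurable:
  assumes "1 \<le> t" "space S = space M" "y t \<in> borel_measurable S" "\<xi> t j \<in> measurable S P"
  shows "\<zeta> t j \<in> borel_measurable S"
  unfolding \<zeta>_def using assms run_simps(4)
  by (intro borel_measurable_diff dF_compose_measurable X_compose_measurable[OF f'_measurable]) auto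

text \<open>The point \<open>y t\<close> is independent of the draw, so the draw may be averaged first, at a fixed point,
where the variance bound applies.\<close>

lemma
  assumes t: "1 \<le> t" and j: "j \<in> {1..N t}"
    and sq: "integrable M (\<lambda>\<omega>. (norm (y t \<omega> - xs))\<^sup>2)"
  shows \<zeta>_square_integrable: "integrable M (\<lambda>\<omega>. (norm (\<zeta> t j \<omega>))\<^sup>2)"
    and \<zeta>_second_moment: "M.expectation (\<lambda>\<omega>. (norm (\<zeta> t j \<omega>))\<^sup>2)
      \<le> 2 * (\<sigma>s\<^sup>2 + \<sigma>L\<^sup>2 * M.expectation (\<lambda>\<omega>. (norm (y t \<omega> - xs))\<^sup>2))"
proof -
  let ?X = "restrict_space borel X"
  define R where "R = 2 * (\<sigma>s\<^sup>2 + \<sigma>L\<^sup>2 * M.expectation (\<lambda>\<omega>. (norm (y t \<omega> - xs))\<^sup>2))"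
  have "y t \<in> measurable (past (t - 1)) ?X"
    using y_past[OF t] run_simps(4)[OF _ t] by (intro measurable_restrict_space2) auto
  moreover have "draws_until (t - 1) \<subseteq> draws_until t - {(t, j)}"
    using t by (auto simp: draws_until_def)
  ultimately have y_X: "y t \<in> measurable M ?X"
    and "distr M (?X \<Otimes>\<^sub>M P) (\<lambda>\<omega>. (y t \<omega>, \<xi> t j \<omega>)) = distr M ?X (y t) \<Otimes>\<^sub>M P"
    using measurable_before_draw[OF t j] distr_pair_draw[OF t j] by blast+
  then have pair: "distr M (?X \<Otimes>\<^sub>M P) (\<lambda>\<omega>. (y t \<omega>, \<xi> t j \<omega>))
      = distr M ?X (y t) \<Otimes>\<^sub>M distr M P (\<xi> t j)"
    by (simp add: draw_distr[OF t j])
  have "(\<lambda>p. dF (fst p) (snd p) - f' (fst p)) \<in> borel_measurable (?X \<Otimes>\<^sub>M P)"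
    using dF_measurable f'_measurable
    by (intro borel_measurable_diff) (auto simp: case_prod_beta intro: measurable_compose[OF measurable_fst])
  then have meas: "(\<lambda>p. ennreal ((norm (dF (fst p) (snd p) - f' (fst p)))\<^sup>2)) \<in> borel_measurable (?X \<Otimes>\<^sub>M P)"
    by measurable
  have \<zeta>_meas: "\<zeta> t j \<in> borel_measurable M"
    using t j by (intro \<zeta>_measurable y_measurable draw_measurable) auto
  have "(\<integral>\<^sup>+\<omega>. ennreal ((norm (\<zeta> t j \<omega>))\<^sup>2) \<partial>M)
      = (\<integral>\<^sup>+\<omega>. (\<integral>\<^sup>+v. ennreal ((norm (dF (y t \<omega>) v - f' (y t \<omega>)))\<^sup>2) \<partial>P) \<partial>M)"
    using M.nn_integral_product_distr[OF y_X draw_measurable[OF t j] pair meas] by (simp add: \<zeta>_def draw_distr[OF t j])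
  also have "\<dots> \<le> (\<integral>\<^sup>+\<omega>. ennreal (2 * (\<sigma>s\<^sup>2 + \<sigma>L\<^sup>2 * (norm (y t \<omega> - xs))\<^sup>2)) \<partial>M)"
    by (intro nn_integral_mono variance_bound run_simps(4) t)
  also have "\<dots> = ennreal (\<integral>\<omega>. 2 * (\<sigma>s\<^sup>2 + \<sigma>L\<^sup>2 * (norm (y t \<omega> - xs))\<^sup>2) \<partial>M)"
    using sq by (intro nn_integral_eq_integral) auto
  also have "(\<integral>\<omega>. 2 * (\<sigma>s\<^sup>2 + \<sigma>L\<^sup>2 * (norm (y t \<omega> - xs))\<^sup>2) \<partial>M) = R"
    using sq by (simp add: R_def M.prob_space)
  finally have le: "(\<integral>\<^sup>+\<omega>. ennreal ((norm (\<zeta> t j \<omega>))\<^sup>2) \<partial>M) \<le> ennreal R" .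
  then show int: "integrable M (\<lambda>\<omega>. (norm (\<zeta> t j \<omega>))\<^sup>2)"
    using \<zeta>_meas by (intro integrableI_bounded) (auto simp: le_less_trans[OF _ ennreal_less_top])
  have "0 \<le> R" by (simp add: R_def)
  then show "M.expectation (\<lambda>\<omega>. (norm (\<zeta> t j \<omega>))\<^sup>2) \<le> R"
    using le int by (subst (asm) nn_integral_eq_integral) auto
qed

lemma integrable_inner_of_squares:
  fixes U V :: "'w \<Rightarrow> 'a"
  assumes "U \<in> borel_measurable M" "V \<in> borel_measurable M"
    and "integrable M (\<lambda>\<omega>. (norm (U \<omega>))\<^sup>2)" "integrable M (\<lambda>\<omega>. (norm (V \<omega>))\<^sup>2)"
  shows "integrable M (\<lambda>\<omega>. U \<omega> \<bullet> V \<omega>)"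
proof (rule Bochner_Integration.integrable_bound)
  show "integrable M (\<lambda>\<omega>. (norm (U \<omega>))\<^sup>2 + (norm (V \<omega>))\<^sup>2)" using assms by simp
  have "\<bar>u \<bullet> v\<bar> \<le> (norm u)\<^sup>2 + (norm v)\<^sup>2" for u v :: 'a
    using Cauchy_Schwarz_ineq2[of u v] sum_squares_bound[of "norm u" "norm v"]
      mult_nonneg_nonneg[of "norm u" "norm v"] by simp
  then show "AE \<omega> in M. norm (U \<omega> \<bullet> V \<omega>) \<le> norm ((norm (U \<omega>))\<^sup>2 + (norm (V \<omega>))\<^sup>2)" by simp
qed (use assms in measurable)

text \<open>At a fixed point, the gradient error of one draw has mean zero, and \<open>y t\<close> and \<open>U\<close> are independent of
the draw.\<close>

lemma \<zeta>_uncorrelated: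
  assumes t: "1 \<le> t" and j: "j \<in> {1..N t}"
    and A: "draws_until (t - 1) \<subseteq> A" "A \<subseteq> draws_until t - {(t, j)}"
    and U: "U \<in> borel_measurable (history M P draw A)"
    and int: "integrable M (\<lambda>\<omega>. U \<omega> \<bullet> \<zeta> t j \<omega>)"
  shows "M.expectation (\<lambda>\<omega>. U \<omega> \<bullet> \<zeta> t j \<omega>) = 0"
proof -
  let ?X = "restrict_space borel X :: 'a measure" and ?B = "borel :: 'a measure"
  let ?h = "\<lambda>p. snd (fst p) \<bullet> (dF (fst (fst p)) (snd p) - f' (fst (fst p)))"
  have "y t \<in> borel_measurable (history M P draw A)"
    by (rule measurable_history_mono[OF A(1) y_past[OF t]])
  then have "(\<lambda>\<omega>. (y t \<omega>, U \<omega>)) \<in> measurable (history M P draw A) (?X \<Otimes>\<^sub>M ?B)"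
    using run_simps(4)[OF _ t] U by (intro measurable_Pair measurable_restrict_space2) auto
  from measurable_before_draw[OF t j A(2) this] distr_pair_draw[OF t j A(2) this]
  have yU: "(\<lambda>\<omega>. (y t \<omega>, U \<omega>)) \<in> measurable M (?X \<Otimes>\<^sub>M ?B)"
    and pair: "distr M ((?X \<Otimes>\<^sub>M ?B) \<Otimes>\<^sub>M P) (\<lambda>\<omega>. ((y t \<omega>, U \<omega>), \<xi> t j \<omega>))
      = distr M (?X \<Otimes>\<^sub>M ?B) (\<lambda>\<omega>. (y t \<omega>, U \<omega>)) \<Otimes>\<^sub>M distr M P (\<xi> t j)"
    by (simp_all add: draw_distr[OF t j])
  have proj: "(\<lambda>p. fst (fst p)) \<in> measurable ((?X \<Otimes>\<^sub>M ?B) \<Otimes>\<^sub>M P) ?X" by measurable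
  have "(\<lambda>p. (fst (fst p), snd p)) \<in> measurable ((?X \<Otimes>\<^sub>M ?B) \<Otimes>\<^sub>M P) (?X \<Otimes>\<^sub>M P)" by measurable
  from measurable_compose[OF this dF_measurable] measurable_compose[OF proj f'_measurable]
  have diff: "(\<lambda>p. dF (fst (fst p)) (snd p) - f' (fst (fst p))) \<in> borel_measurable ((?X \<Otimes>\<^sub>M ?B) \<Otimes>\<^sub>M P)"
    by simp
  have meas: "?h \<in> borel_measurable ((?X \<Otimes>\<^sub>M ?B) \<Otimes>\<^sub>M P)"
    by (rule borel_measurable_inner[OF _ diff]) measurable
  have "M.expectation (\<lambda>\<omega>. ?h ((y t \<omega>, U \<omega>), \<xi> t j \<omega>)) = 0"
  proof (rule M.expectation_product_distr_eq_0[OF yU draw_measurable[OF t j] pair meas])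
    show "integrable M (\<lambda>\<omega>. ?h ((y t \<omega>, U \<omega>), \<xi> t j \<omega>))"
      using int by (simp add: \<zeta>_def)
    fix p assume "p \<in> space (?X \<Otimes>\<^sub>M ?B)"
    then have p: "fst p \<in> X" by (auto simp: space_pair_measure space_restrict_space)
    have "(\<integral>v. snd p \<bullet> (dF (fst p) v - f' (fst p)) \<partial>P)
        = snd p \<bullet> (\<integral>v. dF (fst p) v - f' (fst p) \<partial>P)"
      using dF_integrable[OF p] by (intro integral_inner_right) auto
    also have "(\<integral>v. dF (fst p) v - f' (fst p) \<partial>P) = 0"
      using dF_integrable[OF p] by (simp add: mean_gradient_def prob_space)
    finally show "(\<integral>v. ?h (p, v) \<partial>distr M P (\<xi> t j)) = 0"
      by (simp add: draw_distr[OF t j])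
  qed
  then show ?thesis by (simp add: \<zeta>_def)
qed

abbreviation "w t \<omega> \<equiv> G t \<omega> - f' (y t \<omega>)"

lemma \<zeta>_inner_integrable:
  assumes "1 \<le> t" "i \<in> {1..N t}" "j \<in> {1..N t}"
    and "integrable M (\<lambda>\<omega>. (norm (y t \<omega> - xs))\<^sup>2)"
  shows "integrable M (\<lambda>\<omega>. \<zeta> t i \<omega> \<bullet> \<zeta> t j \<omega>)"
  using assms by (intro integrable_inner_of_squares \<zeta>_square_integrable \<zeta>_measurable
      y_measurable draw_measurable) auto

text \<open>Averaging \<open>N t\<close> uncorrelated errors divides the second moment by \<open>N t\<close>: in the expanded square of
the sum only the diagonal terms have a nonzero expectation.\<close>

lemma
  assumes t: "1 \<le> t" and sq: "integrable M (\<lambda>\<omega>. (norm (y t \<omega> - xs))\<^sup>2)"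
  shows noise_square_integrable: "integrable M (\<lambda>\<omega>. (norm (w t \<omega>))\<^sup>2)"
    and noise_second_moment: "M.expectation (\<lambda>\<omega>. (norm (w t \<omega>))\<^sup>2)
      \<le> 2 * (\<sigma>s\<^sup>2 + \<sigma>L\<^sup>2 * M.expectation (\<lambda>\<omega>. (norm (y t \<omega> - xs))\<^sup>2)) / real (N t)"
proof -
  let ?R = "2 * (\<sigma>s\<^sup>2 + \<sigma>L\<^sup>2 * M.expectation (\<lambda>\<omega>. (norm (y t \<omega> - xs))\<^sup>2))"
  have eq: "(norm (w t \<omega>))\<^sup>2 = (\<Sum>i = 1..N t. \<Sum>j = 1..N t. \<zeta> t i \<omega> \<bullet> \<zeta> t j \<omega>) / (real (N t))\<^sup>2" for \<omega>
  proof -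
    have "(norm (\<Sum>i = 1..N t. \<zeta> t i \<omega>))\<^sup>2 = (\<Sum>i = 1..N t. \<Sum>j = 1..N t. \<zeta> t i \<omega> \<bullet> \<zeta> t j \<omega>)"
      unfolding power2_norm_eq_inner by (subst inner_sum_left, subst inner_sum_right) (rule refl)
    then show ?thesis
      unfolding noise_eq_mean[OF t] by (simp add: power_divide)
  qed
  show "integrable M (\<lambda>\<omega>. (norm (w t \<omega>))\<^sup>2)"
    unfolding eq using sq t by (intro integrable_divide Bochner_Integration.integrable_sum \<zeta>_inner_integrable) auto
  have cross: "M.expectation (\<lambda>\<omega>. \<zeta> t i \<omega> \<bullet> \<zeta> t j \<omega>) = 0"
    if ij: "i \<in> {1..N t}" "j \<in> {1..N t}" "i \<noteq> j" for i j
  proof -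
    \<comment> \<open>The error of draw \<open>i\<close> depends on the past and on that draw only.\<close>
    let ?A = "insert (t, i) (draws_until (t - 1))"
    have "\<zeta> t i \<in> borel_measurable (history M P draw ?A)"
      using measurable_history_mono[OF _ y_past[OF t], of ?A]
        measurable_history_draw[of draw "(t, i)" M P ?A] draw_measurable[OF t ij(1)] t
      by (intro \<zeta>_measurable) auto
    then show ?thesis
      using ij t sq by (intro \<zeta>_uncorrelated[of _ _ ?A] \<zeta>_inner_integrable) (auto simp: draws_until_def)
  qed
  have "M.expectation (\<lambda>\<omega>. (norm (w t \<omega>))\<^sup>2)
      = (\<Sum>i = 1..N t. \<Sum>j = 1..N t. M.expectation (\<lambda>\<omega>. \<zeta> t i \<omega> \<bullet> \<zeta> t j \<omega>)) / (real (N t))\<^sup>2"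
    unfolding eq integral_divide_zero
    using \<zeta>_inner_integrable[OF t _ _ sq]
    by (subst Bochner_Integration.integral_sum)
      (auto intro!: sum.cong arg_cong[where f = "\<lambda>r. r / _"] Bochner_Integration.integral_sum
        Bochner_Integration.integrable_sum)
  also have "(\<Sum>i = 1..N t. \<Sum>j = 1..N t. M.expectation (\<lambda>\<omega>. \<zeta> t i \<omega> \<bullet> \<zeta> t j \<omega>))
      = (\<Sum>i = 1..N t. M.expectation (\<lambda>\<omega>. (norm (\<zeta> t i \<omega>))\<^sup>2))"
  proof (rule sum.cong[OF refl])
    fix i assume i: "i \<in> {1..N t}"
    have "(\<Sum>j = 1..N t. M.expectation (\<lambda>\<omega>. \<zeta> t i \<omega> \<bullet> \<zeta> t j \<omega>))
        = (\<Sum>j = 1..N t. if j = i then M.expectation (\<lambda>\<omega>. \<zeta> t i \<omega> \<bullet> \<zeta> t i \<omega>) else 0)"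
      using cross[OF i] by (intro sum.cong) auto
    then show "(\<Sum>j = 1..N t. M.expectation (\<lambda>\<omega>. \<zeta> t i \<omega> \<bullet> \<zeta> t j \<omega>))
        = M.expectation (\<lambda>\<omega>. (norm (\<zeta> t i \<omega>))\<^sup>2)"
      using i by (simp add: power2_norm_eq_inner)
  qed
  also have "\<dots> / (real (N t))\<^sup>2 \<le> (\<Sum>i = 1..N t. ?R) / (real (N t))\<^sup>2"
    using t sq by (intro divide_right_mono sum_mono \<zeta>_second_moment) auto
  also have "\<dots> = ?R / real (N t)"
    using N_pos[OF t] by (simp add: power2_eq_square)
  finally show "M.expectation (\<lambda>\<omega>. (norm (w t \<omega>))\<^sup>2) \<le> ?R / real (N t)" .
qed

lemma
  assumes t: "1 \<le> t" and sq: "integrable M (\<lambda>\<omega>. (norm (y t \<omega> - xs))\<^sup>2)"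
    and U: "U \<in> borel_measurable (past (t - 1))" and sqU: "integrable M (\<lambda>\<omega>. (norm (U \<omega>))\<^sup>2)"
  shows noise_inner_integrable: "integrable M (\<lambda>\<omega>. w t \<omega> \<bullet> U \<omega>)"
    and noise_uncorrelated: "M.expectation (\<lambda>\<omega>. w t \<omega> \<bullet> U \<omega>) = 0"
proof -
  have eq: "w t \<omega> \<bullet> U \<omega> = (\<Sum>j = 1..N t. U \<omega> \<bullet> \<zeta> t j \<omega>) / real (N t)" for \<omega>
    unfolding noise_eq_mean[OF t] by (simp add: inner_sum_right inner_commute[of _ "U \<omega>"])
  have int: "integrable M (\<lambda>\<omega>. U \<omega> \<bullet> \<zeta> t j \<omega>)" if j: "j \<in> {1..N t}" for j
    using t j sq sqU past_imp_measurable[OF U]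
    by (intro integrable_inner_of_squares \<zeta>_square_integrable \<zeta>_measurable y_measurable
        draw_measurable) auto
  have zero: "M.expectation (\<lambda>\<omega>. U \<omega> \<bullet> \<zeta> t j \<omega>) = 0" if j: "j \<in> {1..N t}" for j
    using t j U int[OF j]
    by (intro \<zeta>_uncorrelated[of _ _ "draws_until (t - 1)"]) (auto simp: draws_until_def)
  show "integrable M (\<lambda>\<omega>. w t \<omega> \<bullet> U \<omega>)"
    unfolding eq using int by (intro integrable_divide Bochner_Integration.integrable_sum) auto
  show "M.expectation (\<lambda>\<omega>. w t \<omega> \<bullet> U \<omega>) = 0"
    unfolding eq using int zero by (simp add: Bochner_Integration.integral_sum)
qed

section \<open>Growth of the mean potential\<close>

text \<open>The auxiliary sequence of accelerated gradient descent. At \<open>t = 0\<close> truncated subtraction makes it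
equal to \<open>z 0\<close>, whatever \<open>\<beta> 0\<close> is.\<close>

definition s :: "nat \<Rightarrow> 'w \<Rightarrow> 'a" where
  "s t \<omega> = z t \<omega> + (\<beta> t - 1) *\<^sub>R (z t \<omega> - z (t - 1) \<omega>)"

text \<open>The weight 0 at time 0 is exact: since \<open>\<beta> 1 = 1\<close>, the first iteration does not see the gap at \<open>z 0\<close>,
which thus never enters the potential.\<close>

definition weight :: "nat \<Rightarrow> real" where
  "weight t = (if t = 0 then 0 else (\<beta> t)\<^sup>2)"

definition V :: "nat \<Rightarrow> 'w \<Rightarrow> real" where
  "V t \<omega> = 2 * \<gamma> * weight t * (g (z t \<omega>) - g xs) + (norm (s t \<omega> - xs))\<^sup>2"

lemma s_past: "s t \<in> borel_measurable (past t)"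
proof -
  have [measurable]: "z t \<in> borel_measurable (past t)" "z (t - 1) \<in> borel_measurable (past t)"
    using iterates_measurable_past[of t] by auto
  show ?thesis unfolding s_def by measurable
qed

lemma s_measurable: "s t \<in> borel_measurable M"
  by (rule past_imp_measurable[OF s_past])

lemma gap_nonneg: "\<omega> \<in> space M \<Longrightarrow> 0 \<le> g (z t \<omega>) - g xs"
  using g_min[OF z_in_X] by simp

lemma weight_nonneg: "0 \<le> weight t"
  by (simp add: weight_def)

lemma V_ge_distance: "\<omega> \<in> space M \<Longrightarrow> (norm (s t \<omega> - xs))\<^sup>2 \<le> V t \<omega>"
  using gap_nonneg[of \<omega> t] \<gamma>_pos weight_nonneg[of t] by (simp add: V_def)

lemma V_nonneg: "\<omega> \<in> space M \<Longrightarrow> 0 \<le> V t \<omega>"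
  using V_ge_distance[of \<omega> t] by (meson order_trans zero_le_power2)

lemma V_measurable: "V t \<in> borel_measurable M"
proof (cases "t = 0")
  case True
  then show ?thesis unfolding V_def weight_def using s_measurable[of 0] by simp
next
  case False
  then show ?thesis unfolding V_def using s_measurable[of t] g_z_measurable[of t] by simp
qed

text \<open>The extrapolation rule in the form that \<open>accelerated_potential_step\<close> asks for.\<close>

lemma \<beta>_y:
  assumes \<omega>: "\<omega> \<in> space M" and t: "1 \<le> t"
  shows "\<beta> t *\<^sub>R y t \<omega> = (\<beta> t - 1) *\<^sub>R z (t - 1) \<omega> + s (t - 1) \<omega>"
proof (cases "t = 1")
  case True
  then show ?thesis
    using run_simps(1,2)[OF \<omega>] \<beta>_1 by (simp add: s_def)
next
  case False
  then obtain r where r: "t = r + 1" "1 \<le> r" using t by (cases t) auto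
  have "\<beta> t *\<^sub>R y t \<omega> = (\<beta> r - 1) *\<^sub>R (z r \<omega> - z (r - 1) \<omega>) + \<beta> t *\<^sub>R z r \<omega>"
    unfolding r(1) run_simps(6)[OF \<omega> r(2)] using \<beta>_ge_1[of "r + 1"]
    by (simp add: scaleR_add_right)
  then show ?thesis using r(1) by (simp add: s_def algebra_simps)
qed

lemma weight_step: "1 \<le> t \<Longrightarrow> (\<beta> t)\<^sup>2 - \<beta> t \<le> weight (t - 1)"
  using \<beta>_step[of "t - 1"] \<beta>_1 by (cases "t = 1") (auto simp: weight_def)

lemma V_step:
  assumes \<omega>: "\<omega> \<in> space M" and t: "1 \<le> t"
  shows "V t \<omega> \<le> V (t - 1) \<omega> + 2 * \<gamma> * \<beta> t * (w t \<omega> \<bullet> (xs - s (t - 1) \<omega>))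
    + \<gamma> * (\<beta> t)\<^sup>2 / (1 / \<gamma> - L) * (norm (w t \<omega>))\<^sup>2"
proof -
  have "2 * \<gamma> * ((\<beta> t)\<^sup>2 - \<beta> t) * (g (z (t - 1) \<omega>) - g xs)
      \<le> 2 * \<gamma> * weight (t - 1) * (g (z (t - 1) \<omega>) - g xs)"
    using weight_step[OF t] gap_nonneg[OF \<omega>] \<gamma>_pos by (intro mult_right_mono mult_left_mono) auto
  moreover have "2 * \<gamma> * (\<beta> t)\<^sup>2 * (g (z t \<omega>) - g xs) + (norm (s t \<omega> - xs))\<^sup>2
    \<le> 2 * \<gamma> * ((\<beta> t)\<^sup>2 - \<beta> t) * (g (z (t - 1) \<omega>) - g xs) + (norm (s (t - 1) \<omega> - xs))\<^sup>2
      + 2 * \<gamma> * \<beta> t * (w t \<omega> \<bullet> (xs - s (t - 1) \<omega>))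
      + \<gamma> * (\<beta> t)\<^sup>2 / (1 / \<gamma> - L) * (norm (w t \<omega>))\<^sup>2"
    unfolding composite_objective_def
    by (rule accelerated_potential_step[OF convex_X f_convex f_gradient gradient_Lipschitz \<phi>_convex
          \<gamma>_pos \<gamma>_less run_simps(5)[OF \<omega> t] run_simps(4)[OF \<omega> t] z_in_X[OF \<omega>] xs_in_X
          \<beta>_ge_1[OF t] \<beta>_y[OF \<omega> t] s_def])
  ultimately show ?thesis
    using t unfolding V_def[of t] V_def[of "t - 1"] weight_def[of t] by simp
qed

lemma y_distance_le:
  assumes \<omega>: "\<omega> \<in> space M" and t: "1 \<le> t"
  shows "(norm (y t \<omega> - xs))\<^sup>2 \<le> (1 - 1 / \<beta> t) * (norm (z (t - 1) \<omega> - xs))\<^sup>2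
    + 1 / \<beta> t * (norm (s (t - 1) \<omega> - xs))\<^sup>2"
proof -
  have "\<beta> t *\<^sub>R ((1 - 1 / \<beta> t) *\<^sub>R (z (t - 1) \<omega> - xs) + (1 / \<beta> t) *\<^sub>R (s (t - 1) \<omega> - xs))
      = \<beta> t *\<^sub>R (y t \<omega> - xs)"
    using \<beta>_ge_1[OF t] \<beta>_y[OF \<omega> t] by (simp add: algebra_simps)
  then have "y t \<omega> - xs = (1 - 1 / \<beta> t) *\<^sub>R (z (t - 1) \<omega> - xs) + (1 / \<beta> t) *\<^sub>R (s (t - 1) \<omega> - xs)"
    using \<beta>_ge_1[OF t] by simp
  then show ?thesis using norm_sq_convex_combination[of "1 / \<beta> t"] \<beta>_ge_1[OF t] by simp
qed

lemma z_distance_le: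
  assumes t: "1 \<le> t"
  shows "(norm (z t \<omega> - xs))\<^sup>2 \<le> (1 - 1 / \<beta> t) * (norm (z (t - 1) \<omega> - xs))\<^sup>2
    + 1 / \<beta> t * (norm (s t \<omega> - xs))\<^sup>2"
proof -
  have "\<beta> t *\<^sub>R ((1 - 1 / \<beta> t) *\<^sub>R (z (t - 1) \<omega> - xs) + (1 / \<beta> t) *\<^sub>R (s t \<omega> - xs))
      = \<beta> t *\<^sub>R (z t \<omega> - xs)"
    using \<beta>_ge_1[OF t] by (simp add: s_def algebra_simps)
  then have "z t \<omega> - xs = (1 - 1 / \<beta> t) *\<^sub>R (z (t - 1) \<omega> - xs) + (1 / \<beta> t) *\<^sub>R (s t \<omega> - xs)"
    using \<beta>_ge_1[OF t] by simp
  then show ?thesis using norm_sq_convex_combination[of "1 / \<beta> t"] \<beta>_ge_1[OF t] by simp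
qed

text \<open>The growth rate in the Gronwall argument, per unit of \<open>(\<beta> t)\<^sup>2 / N t\<close>: the constant of the
quadratic noise term, times the factor 2 of the variance bound, times \<open>\<sigma>s\<^sup>2 + \<sigma>L\<^sup>2\<close>, which bounds
\<open>(\<sigma>s\<^sup>2 + \<sigma>L\<^sup>2 d) / (1 + d)\<close> for \<open>d \<ge> 0\<close>.\<close>

definition noise_factor :: real where
  "noise_factor = 2 * \<gamma> * (\<sigma>s\<^sup>2 + \<sigma>L\<^sup>2) / (1 / \<gamma> - L)"

definition potential_bound :: "nat \<Rightarrow> real" where
  "potential_bound t = (1 + (norm (x1 - xs))\<^sup>2) * exp (noise_factor * (\<Sum>i = 1..t. (\<beta> i)\<^sup>2 / real (N i))) - 1"

lemma noise_factor_nonneg: "0 \<le> noise_factor"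
  using \<gamma>_pos \<gamma>_less by (simp add: noise_factor_def)

text \<open>The discrete Gronwall step: \<open>1 + x \<le> exp x\<close> turns the recursion of the mean potential into growth
of \<open>1 + potential_bound\<close> by an exponential factor.\<close>

lemma potential_bound_step:
  assumes "1 \<le> t"
  shows "potential_bound (t - 1) + noise_factor * (\<beta> t)\<^sup>2 / real (N t) * (1 + potential_bound (t - 1)) \<le> potential_bound t"
proof -
  obtain r where r: "t = Suc r" using assms by (cases t) auto
  let ?S = "\<Sum>i = 1..r. (\<beta> i)\<^sup>2 / real (N i)" and ?q = "noise_factor * (\<beta> t)\<^sup>2 / real (N t)"
  have "(1 + potential_bound r) * (1 + ?q) \<le> (1 + potential_bound r) * exp ?q"
    by (intro mult_left_mono exp_ge_add_one_self) (simp add: potential_bound_def)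
  also have "\<dots> = 1 + potential_bound t"
    by (simp add: potential_bound_def r distrib_left exp_add)
  finally show ?thesis by (simp add: r algebra_simps)
qed

lemma potential_bound_mono: "1 \<le> t \<Longrightarrow> potential_bound (t - 1) \<le> potential_bound t"
  unfolding potential_bound_def using noise_factor_nonneg
  by (intro diff_mono mult_left_mono iffD2[OF exp_le_cancel_iff] sum_mono2) auto

text \<open>The mean square distance of \<open>z t\<close> has to be carried along in the induction. Together with the mean
potential, which dominates the mean square distance of \<open>s t\<close>, it bounds the second moment of the next
point \<open>y\<close>, and thus the noise of the next batch.\<close>

lemma potential_bounded:
  "integrable M (V t) \<and> M.expectation (V t) \<le> potential_bound t \<and>
   integrable M (\<lambda>\<omega>. (norm (z t \<omega> - xs))\<^sup>2) \<and> M.expectation (\<lambda>\<omega>. (norm (z t \<omega> - xs))\<^sup>2) \<le> potential_bound t"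
proof (induction t)
  case 0
  have z0: "(norm (z 0 \<omega> - xs))\<^sup>2 = (norm (x1 - xs))\<^sup>2" and V0: "V 0 \<omega> = (norm (x1 - xs))\<^sup>2"
    if "\<omega> \<in> space M" for \<omega>
    using run_simps(2)[OF that] by (simp_all add: V_def weight_def s_def)
  have "integrable M (V 0)" "integrable M (\<lambda>\<omega>. (norm (z 0 \<omega> - xs))\<^sup>2)"
    by (subst Bochner_Integration.integrable_cong[OF refl, where g = "\<lambda>_. (norm (x1 - xs))\<^sup>2"];
        simp add: z0 V0)+
  moreover have "M.expectation (V 0) = (norm (x1 - xs))\<^sup>2"
    "M.expectation (\<lambda>\<omega>. (norm (z 0 \<omega> - xs))\<^sup>2) = (norm (x1 - xs))\<^sup>2"
    by (subst Bochner_Integration.integral_cong[OF refl, where g = "\<lambda>_. (norm (x1 - xs))\<^sup>2"];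
        simp add: z0 V0 M.prob_space)+
  ultimately show ?case by (simp add: potential_bound_def)
next
  case (Suc r)
  define t where "t = Suc r"
  have t: "1 \<le> t" "t - 1 = r" by (simp_all add: t_def)
  define \<tau> where "\<tau> = 1 / \<beta> t"
  have \<tau>: "0 \<le> \<tau>" "\<tau> \<le> 1" using \<beta>_ge_1[OF t(1)] by (simp_all add: \<tau>_def)
  have int_V: "integrable M (V r)" and EV: "M.expectation (V r) \<le> potential_bound r"
    and int_z: "integrable M (\<lambda>\<omega>. (norm (z r \<omega> - xs))\<^sup>2)"
    and Ez: "M.expectation (\<lambda>\<omega>. (norm (z r \<omega> - xs))\<^sup>2) \<le> potential_bound r"
    using Suc.IH by auto
  have [measurable]: "s r \<in> borel_measurable M" "z t \<in> borel_measurable M" "y t \<in> borel_measurable M"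
    "V t \<in> borel_measurable M"
    by (rule s_measurable z_measurable y_measurable[OF t(1)] V_measurable)+
  have int_s: "integrable M (\<lambda>\<omega>. (norm (s r \<omega> - xs))\<^sup>2)"
    by (rule Bochner_Integration.integrable_bound[OF int_V])
      (auto intro!: AE_I2 simp: V_ge_distance V_nonneg)
  let ?y = "\<lambda>\<omega>. (1 - \<tau>) * (norm (z r \<omega> - xs))\<^sup>2 + \<tau> * V r \<omega>"
  \<comment> \<open>In both convex combinations \<open>s\<close> is replaced by the potential, whose mean is under control.\<close>
  have le_y: "(norm (y t \<omega> - xs))\<^sup>2 \<le> ?y \<omega>" if "\<omega> \<in> space M" for \<omega>
    using y_distance_le[OF that t(1)] mult_left_mono[OF V_ge_distance[OF that, of r] \<tau>(1)]
    by (simp add: t_def \<tau>_def)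
  have int_y': "integrable M ?y" using int_V int_z by simp
  have int_y: "integrable M (\<lambda>\<omega>. (norm (y t \<omega> - xs))\<^sup>2)"
    by (rule Bochner_Integration.integrable_bound[OF int_y'])
      (auto intro!: AE_I2 order_trans[OF le_y])
  have "M.expectation (\<lambda>\<omega>. (norm (y t \<omega> - xs))\<^sup>2) \<le> M.expectation ?y"
    by (intro integral_mono int_y int_y' le_y)
  also have "\<dots> = (1 - \<tau>) * M.expectation (\<lambda>\<omega>. (norm (z r \<omega> - xs))\<^sup>2) + \<tau> * M.expectation (V r)"
    using int_V int_z by simp
  also have "\<dots> \<le> potential_bound r"
    using \<tau> EV Ez by (intro convex_bound_le) auto
  finally have Ey: "M.expectation (\<lambda>\<omega>. (norm (y t \<omega> - xs))\<^sup>2) \<le> potential_bound r" .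
  have U: "(\<lambda>\<omega>. xs - s r \<omega>) \<in> borel_measurable (past (t - 1))"
    using s_past[of r] by (simp add: t_def)
  have sqU: "integrable M (\<lambda>\<omega>. (norm (xs - s r \<omega>))\<^sup>2)"
    using int_s by (simp add: norm_minus_commute)
  note inner = noise_inner_integrable[OF t(1) int_y U sqU] noise_uncorrelated[OF t(1) int_y U sqU]
  note square = noise_square_integrable[OF t(1) int_y]
  let ?c = "\<gamma> * (\<beta> t)\<^sup>2 / (1 / \<gamma> - L)"
  let ?V = "\<lambda>\<omega>. V r \<omega> + 2 * \<gamma> * \<beta> t * (w t \<omega> \<bullet> (xs - s r \<omega>)) + ?c * (norm (w t \<omega>))\<^sup>2"
  have c: "0 \<le> ?c" using \<gamma>_pos \<gamma>_less by simp
  have le_V: "V t \<omega> \<le> ?V \<omega>" if "\<omega> \<in> space M" for \<omega>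
    using V_step[OF that t(1)] unfolding t(2) .
  have int_V': "integrable M ?V" using int_V inner(1) square by simp
  have int_Vt: "integrable M (V t)"
    by (rule Bochner_Integration.integrable_bound[OF int_V'])
      (auto intro!: AE_I2 order_trans[OF le_V] simp: V_nonneg)
  have "M.expectation (V t) \<le> M.expectation ?V"
    by (intro integral_mono int_Vt int_V' le_V)
  also have "\<dots> = M.expectation (V r) + ?c * M.expectation (\<lambda>\<omega>. (norm (w t \<omega>))\<^sup>2)"
    using int_V inner square by simp
  also have "\<dots> \<le> potential_bound r + ?c * (2 * (\<sigma>s\<^sup>2 + \<sigma>L\<^sup>2) * (1 + potential_bound r) / real (N t))"
  proof (intro add_mono mult_left_mono EV c)
    have "0 \<le> potential_bound r" using EV Bochner_Integration.integral_nonneg[of M "V r"] V_nonneg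
      by (meson order_trans)
    then have "\<sigma>s\<^sup>2 + \<sigma>L\<^sup>2 * potential_bound r \<le> (\<sigma>s\<^sup>2 + \<sigma>L\<^sup>2) * (1 + potential_bound r)"
      by (simp add: algebra_simps)
    then have "\<sigma>s\<^sup>2 + \<sigma>L\<^sup>2 * M.expectation (\<lambda>\<omega>. (norm (y t \<omega> - xs))\<^sup>2) \<le> (\<sigma>s\<^sup>2 + \<sigma>L\<^sup>2) * (1 + potential_bound r)"
      using mult_left_mono[OF Ey, of "\<sigma>L\<^sup>2"] by simp
    then have "2 * (\<sigma>s\<^sup>2 + \<sigma>L\<^sup>2 * M.expectation (\<lambda>\<omega>. (norm (y t \<omega> - xs))\<^sup>2)) / real (N t)
        \<le> 2 * (\<sigma>s\<^sup>2 + \<sigma>L\<^sup>2) * (1 + potential_bound r) / real (N t)"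
      unfolding mult.assoc by (intro divide_right_mono mult_left_mono) auto
    with noise_second_moment[OF t(1) int_y]
    show "M.expectation (\<lambda>\<omega>. (norm (w t \<omega>))\<^sup>2) \<le> 2 * (\<sigma>s\<^sup>2 + \<sigma>L\<^sup>2) * (1 + potential_bound r) / real (N t)"
      by (rule order_trans)
  qed
  also have "\<dots> = potential_bound r + noise_factor * (\<beta> t)\<^sup>2 / real (N t) * (1 + potential_bound r)"
    by (simp add: noise_factor_def)
  also have "\<dots> \<le> potential_bound t"
    using potential_bound_step[OF t(1)] unfolding t(2) .
  finally have EVt: "M.expectation (V t) \<le> potential_bound t" .
  let ?z = "\<lambda>\<omega>. (1 - \<tau>) * (norm (z r \<omega> - xs))\<^sup>2 + \<tau> * V t \<omega>"
  have le_z: "(norm (z t \<omega> - xs))\<^sup>2 \<le> ?z \<omega>" if "\<omega> \<in> space M" for \<omega>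
    using z_distance_le[OF t(1), of \<omega>] mult_left_mono[OF V_ge_distance[OF that, of t] \<tau>(1)]
    by (simp add: t_def \<tau>_def)
  have int_z': "integrable M ?z" using int_Vt int_z by simp
  have int_zt: "integrable M (\<lambda>\<omega>. (norm (z t \<omega> - xs))\<^sup>2)"
    by (rule Bochner_Integration.integrable_bound[OF int_z'])
      (auto intro!: AE_I2 order_trans[OF le_z])
  have "M.expectation (\<lambda>\<omega>. (norm (z t \<omega> - xs))\<^sup>2) \<le> M.expectation ?z"
    by (intro integral_mono int_zt int_z' le_z)
  also have "\<dots> = (1 - \<tau>) * M.expectation (\<lambda>\<omega>. (norm (z r \<omega> - xs))\<^sup>2) + \<tau> * M.expectation (V t)"
    using int_Vt int_z by simp
  also have "\<dots> \<le> potential_bound t"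
    using \<tau> EVt order_trans[OF Ez potential_bound_mono[OF t(1), unfolded t(2)]]
    by (intro convex_bound_le) auto
  finally show ?case using int_Vt EVt int_zt by (simp add: t_def)
qed

theorem expected_gap_le:
  assumes t: "1 \<le> t"
  shows "integrable M (\<lambda>\<omega>. g (z t \<omega>) - optimal_value X g)"
    and "M.expectation (\<lambda>\<omega>. g (z t \<omega>) - optimal_value X g)
      \<le> (1 + (norm (x1 - xs))\<^sup>2) * exp (noise_factor * (\<Sum>i = 1..t. (\<beta> i)\<^sup>2 / real (N i)))
        / (2 * \<gamma> * (\<beta> t)\<^sup>2)"
proof -
  have c: "0 < 2 * \<gamma> * (\<beta> t)\<^sup>2" using \<gamma>_pos \<beta>_ge_1[OF t] by simp
  have le: "g (z t \<omega>) - g xs \<le> V t \<omega> / (2 * \<gamma> * (\<beta> t)\<^sup>2)" if "\<omega> \<in> space M" for \<omega>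
    using c t by (simp add: V_def weight_def pos_le_divide_eq mult.commute)
  have int_V: "integrable M (\<lambda>\<omega>. V t \<omega> / (2 * \<gamma> * (\<beta> t)\<^sup>2))"
    using potential_bounded[of t] by simp
  have int: "integrable M (\<lambda>\<omega>. g (z t \<omega>) - g xs)"
  proof (rule Bochner_Integration.integrable_bound[OF int_V])
    have "norm (g (z t \<omega>) - g xs) \<le> norm (V t \<omega> / (2 * \<gamma> * (\<beta> t)\<^sup>2))" if "\<omega> \<in> space M" for \<omega>
      using order_trans[OF le[OF that] abs_ge_self] gap_nonneg[OF that, of t] by simp
    then show "AE \<omega> in M. norm (g (z t \<omega>) - g xs) \<le> norm (V t \<omega> / (2 * \<gamma> * (\<beta> t)\<^sup>2))"
      by (rule AE_I2)
  qed (use g_z_measurable[OF t] in simp)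
  then show "integrable M (\<lambda>\<omega>. g (z t \<omega>) - optimal_value X g)" by (simp add: optimal_value_eq)
  have "M.expectation (\<lambda>\<omega>. g (z t \<omega>) - g xs) \<le> M.expectation (\<lambda>\<omega>. V t \<omega> / (2 * \<gamma> * (\<beta> t)\<^sup>2))"
    by (intro integral_mono int int_V le)
  also have "\<dots> = M.expectation (V t) / (2 * \<gamma> * (\<beta> t)\<^sup>2)" by simp
  also have "\<dots> \<le> (potential_bound t + 1) / (2 * \<gamma> * (\<beta> t)\<^sup>2)"
    using potential_bounded[of t] c by (intro divide_right_mono) auto
  finally show "M.expectation (\<lambda>\<omega>. g (z t \<omega>) - optimal_value X g)
      \<le> (1 + (norm (x1 - xs))\<^sup>2) * exp (noise_factor * (\<Sum>i = 1..t. (\<beta> i)\<^sup>2 / real (N i)))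
        / (2 * \<gamma> * (\<beta> t)\<^sup>2)"
    by (simp add: potential_bound_def optimal_value_eq)
qed

end

section \<open>Iteration and oracle complexity\<close>

theorem corollary2:
  fixes P :: "'s measure" and M :: "'w measure"
    and X :: "'a::euclidean_space set"
    and F :: "'a \<Rightarrow> 's \<Rightarrow> real" and dF :: "'a \<Rightarrow> 's \<Rightarrow> 'a" and \<phi> :: "'a \<Rightarrow> real"
    and L \<sigma>L \<mu> a b \<delta> \<theta> :: real and N0 :: nat and t0 :: int
    and \<alpha> \<beta> :: "nat \<Rightarrow> real" and N :: "nat \<Rightarrow> nat"
    and \<xi> :: "nat \<Rightarrow> nat \<Rightarrow> 'w \<Rightarrow> 's" and x1 :: 'a and y z :: "nat \<Rightarrow> 'w \<Rightarrow> 'a"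
  assumes problem: "stochastic_composite_problem P X F dF \<phi> L"
    and noise: "multiplicative_noise P X dF \<sigma>L"
    and run: "accelerated_run M P X F dF \<phi> \<alpha> \<beta> N \<xi> x1 y z"
    and \<alpha>_noninc: "\<And>s t. \<lbrakk>1 \<le> s; s \<le> t\<rbrakk> \<Longrightarrow> \<alpha> t \<le> \<alpha> s"
    and \<alpha>_range: "\<And>t. 1 \<le> t \<Longrightarrow> 0 < \<alpha> t \<and> \<alpha> t < 1 / L"
    and \<beta>_ge_1: "\<And>t. 1 \<le> t \<Longrightarrow> 1 \<le> \<beta> t"
    and \<beta>_step: "\<And>t. 1 \<le> t \<Longrightarrow> (\<beta> (t + 1))\<^sup>2 - \<beta> (t + 1) \<le> (\<beta> t)\<^sup>2"
    and \<mu>: "0 < \<mu>" "\<mu> < 1"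
    and pos: "0 < a" "0 < b" "0 < \<delta>" "1 \<le> N0"
    and \<beta>_def: "\<And>t. 1 \<le> t \<Longrightarrow> \<beta> t = (1 + real t) / 2"
    and \<alpha>_def: "\<And>t. 1 \<le> t \<Longrightarrow> \<alpha> t = \<mu> / (L + a / sqrt (real N0))"
    and N_def: "\<And>t. 1 \<le> t \<Longrightarrow>
      N t = N0 * nat \<lceil>(real t + 2 + \<delta>) ^ 3 * ln (real t + 2 + \<delta>) powr (1 + 2 * b)\<rceil>"
    and \<theta>: "0 < \<theta>" "\<theta> < 1"
    and t0_def: "t0 = max
      \<lceil>exp ((15 * (\<alpha> 1 * \<sigma>L)\<^sup>2 / (8 * \<theta> * real N0 * b)) powr (1 / (2 * b))) - 1 - \<delta>\<rceil> 1"
  shows "\<exists>T :: real \<Rightarrow> nat.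
      (\<forall>\<epsilon>>0. 1 \<le> T \<epsilon> \<and>
         integrable M (\<lambda>\<omega>. composite_objective P F \<phi> (z (T \<epsilon>) \<omega>)
                           - optimal_value X (composite_objective P F \<phi>)) \<and>
         (\<integral>\<omega>. (composite_objective P F \<phi> (z (T \<epsilon>) \<omega>)
                - optimal_value X (composite_objective P F \<phi>)) \<partial>M) \<le> \<epsilon>) \<and>
      (\<lambda>\<epsilon>. real (T \<epsilon>)) \<in> O[at_right 0](\<lambda>\<epsilon>. \<epsilon> powr (- 1 / 2)) \<and>
      (\<lambda>\<epsilon>. \<Sum>\<tau> = 1..T \<epsilon>. real (N \<tau>)) \<in>
        O[at_right 0](\<lambda>\<epsilon>. \<epsilon> powr (- 2) * ln (\<epsilon> powr (- 1 / 2)) powr max 2 (1 + 2 * b))"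
proof -
  interpret stochastic_composite_problem P X F dF \<phi> L by (rule problem)
  let ?g = "composite_objective P F \<phi>"
  obtain xs where xs: "xs \<in> solution_set X ?g" using solution_exists by blast
  define \<gamma> where "\<gamma> = \<mu> / (L + a / sqrt (real N0))"
  have \<gamma>: "0 < \<gamma>" "\<gamma> < 1 / L" using \<alpha>_range[of 1] \<alpha>_def[of 1] by (simp_all add: \<gamma>_def)
  define c p where "c = 2 + \<delta>" and "p = 2 * b"
  have c: "2 \<le> c" and p: "0 < p" using pos by (simp_all add: c_def p_def)
  have N: "N t = N0 * nat \<lceil>(real t + c) ^ 3 * ln (real t + c) powr (1 + p)\<rceil>" if "1 \<le> t" for t
    using N_def[OF that] by (simp add: c_def p_def add.assoc)
  have N_ge: "(real t + c) ^ 3 * ln (real t + c) powr (1 + p) \<le> real (N t)" if "1 \<le> t" for t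
  proof -
    have "h \<le> real N0 * real (nat \<lceil>h\<rceil>)" for h :: real
      using real_nat_ceiling_ge[of h] mult_right_mono[of 1 "real N0" "real (nat \<lceil>h\<rceil>)"] pos(4)
      by simp
    then show ?thesis unfolding N[OF that] by simp
  qed
  interpret accelerated_method P X F dF \<phi> L M \<sigma>L \<gamma> \<alpha> \<beta> N \<xi> x1 xs y z
  proof
    show "multiplicative_noise P X dF \<sigma>L" "accelerated_run M P X F dF \<phi> \<alpha> \<beta> N \<xi> x1 y z"
      "0 < \<gamma>" "xs \<in> solution_set X ?g"
      by (fact noise run \<gamma>(1) xs)+
    show "L < 1 / \<gamma>" using \<gamma> L_pos by (simp add: field_simps)
    show "\<beta> 1 = 1" using \<beta>_def[of 1] by simp
    fix t :: nat assume t: "1 \<le> t"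
    show "\<alpha> t = \<gamma>" using \<alpha>_def[OF t] by (simp add: \<gamma>_def)
    show "1 \<le> \<beta> t" "(\<beta> (t + 1))\<^sup>2 - \<beta> (t + 1) \<le> (\<beta> t)\<^sup>2" by (rule \<beta>_ge_1[OF t] \<beta>_step[OF t])+
    have "0 < (real t + c) ^ 3 * ln (real t + c) powr (1 + p)" using c t by simp
    then show "1 \<le> N t" using N_ge[OF t] by linarith
  qed
  \<comment> \<open>The value of the Gronwall bound when the partial sums are replaced by their limit bound.\<close>
  define H where "H = (1 + (norm (x1 - xs))\<^sup>2) * exp (noise_factor * (ln c powr (- p) / p))"
  define C where "C = 2 * H / \<gamma>"
  have C: "0 < C" using \<gamma>(1) by (simp add: C_def H_def add_pos_nonneg)
  have rate: "M.expectation (\<lambda>\<omega>. ?g (z t \<omega>) - optimal_value X ?g) \<le> C / (real t)\<^sup>2"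
    if t: "1 \<le> t" for t
  proof -
    have "(\<Sum>i = 1..t. (\<beta> i)\<^sup>2 / real (N i)) = (\<Sum>i = 1..t. ((1 + real i) / 2)\<^sup>2 / real (N i))"
      by (intro sum.cong) (auto simp: \<beta>_def)
    also have "\<dots> \<le> ln c powr (- p) / p"
      using c by (intro sum_weight_over_batch_le p N_ge) auto
    finally have "(1 + (norm (x1 - xs))\<^sup>2) * exp (noise_factor * (\<Sum>i = 1..t. (\<beta> i)\<^sup>2 / real (N i))) \<le> H"
      unfolding H_def using noise_factor_nonneg
      by (intro mult_left_mono iffD2[OF exp_le_cancel_iff]) auto
    then have "(1 + (norm (x1 - xs))\<^sup>2) * exp (noise_factor * (\<Sum>i = 1..t. (\<beta> i)\<^sup>2 / real (N i)))
        / (2 * \<gamma> * (\<beta> t)\<^sup>2) \<le> H / (2 * \<gamma> * (real t / 2)\<^sup>2)"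
      using \<gamma>(1) t by (intro frac_le mult_left_mono power_mono) (auto simp: \<beta>_def H_def)
    also have "\<dots> = C / (real t)\<^sup>2" by (simp add: C_def power_divide)
    finally show ?thesis using expected_gap_le(2)[OF t] by linarith
  qed
  define T where "T \<epsilon> = max 1 (nat \<lceil>sqrt (C / \<epsilon>)\<rceil>)" for \<epsilon>
  have T_ge: "1 \<le> T \<epsilon>" for \<epsilon> by (simp add: T_def)
  have gap: "M.expectation (\<lambda>\<omega>. ?g (z (T \<epsilon>) \<omega>) - optimal_value X ?g) \<le> \<epsilon>" if \<epsilon>: "0 < \<epsilon>" for \<epsilon>
  proof -
    have "sqrt (C / \<epsilon>) \<le> real (T \<epsilon>)"
      using real_nat_ceiling_ge[of "sqrt (C / \<epsilon>)"] by (simp add: T_def le_max_iff_disj)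
    then have "C / \<epsilon> \<le> (real (T \<epsilon>))\<^sup>2" using sqrt_le_D by blast
    then have "C / (real (T \<epsilon>))\<^sup>2 \<le> \<epsilon>"
      using \<epsilon> T_ge[of \<epsilon>] by (simp add: field_simps)
    then show ?thesis using rate[OF T_ge[of \<epsilon>]] by linarith
  qed
  have large: "eventually (\<lambda>\<epsilon>::real. 1 \<le> \<epsilon> powr (- 1 / 2)) (at_right 0)"
    using eventually_powr_neg_ge_at_right_0[of "1 / 2" 1] by simp
  have T_bigo: "(\<lambda>\<epsilon>. real (T \<epsilon>)) \<in> O[at_right 0](\<lambda>\<epsilon>. \<epsilon> powr (- 1 / 2))"
  proof (rule bigoI)
    show "eventually (\<lambda>\<epsilon>. norm (real (T \<epsilon>)) \<le> (sqrt C + 1) * norm (\<epsilon> powr (- 1 / 2))) (at_right 0)"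
      using large eventually_at_right_less
    proof eventually_elim
      case (elim \<epsilon>)
      have root: "sqrt (C / \<epsilon>) = sqrt C * \<epsilon> powr (- 1 / 2)"
        using powr_half_sqrt[of \<epsilon>] powr_minus_divide[of \<epsilon> "1 / 2"] elim
        by (simp add: real_sqrt_divide)
      have "0 \<le> sqrt (C / \<epsilon>)" using C elim by simp
      moreover have "real (max 1 (nat \<lceil>r\<rceil>)) \<le> r + 1" if "0 \<le> r" for r :: real
        using that by linarith
      ultimately have "real (T \<epsilon>) \<le> sqrt (C / \<epsilon>) + 1" unfolding T_def by blast
      also have "\<dots> \<le> (sqrt C + 1) * \<epsilon> powr (- 1 / 2)"
        using elim unfolding root by (simp add: distrib_right)
      finally show ?case by simp
    qed
  qed
  have "(\<lambda>\<epsilon>. \<Sum>\<tau> = 1..T \<epsilon>. real (N \<tau>)) \<in>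
      O[at_right 0](\<lambda>\<epsilon>. \<epsilon> powr (- 2) * ln (\<epsilon> powr (- 1 / 2)) powr max 2 (1 + 2 * b))"
  proof (rule power4_mult_ln_powr_bigo[OF T_bigo])
    show "(\<Sum>\<tau> = 1..n. real (N \<tau>)) \<le> 2 * real N0 * (real n + c) ^ 4 * ln (real n + c) powr (1 + p)" for n
      using p by (intro sum_batch_le c N) simp_all
    show "1 \<le> c" "0 \<le> 1 + p" "1 + p \<le> max 2 (1 + 2 * b)" "0 \<le> 2 * real N0"
      using c p by (simp_all add: p_def)
  qed (simp add: sum_nonneg)
  then show ?thesis
    using T_ge gap T_bigo expected_gap_le(1)[OF T_ge] by (intro exI[of _ T] conjI allI impI) blast+
qed

end
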